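(* Let $e>0$ be fixed, let $f:\mathbb{R}\to\mathbb{R}$ be a continuous function satisfying (f1) $\lim_{|s|\to\infty} f(s)/s=0$; (f2) $\lim_{s\to 0} f(s)/s=0$; (f3) there exists $s_0\in\mathbb{R}$ with $F(s_0)>0$, where $F(s)=\int_0^s f(t)\,dt$, and let $\alpha\in L^\infty(\mathbb{R}^3)$. Define $$c_f=\max_{s\neq 0}\frac{|f(s)|}{|s|+4\sqrt{\pi}\,e\,s^2}>0.$$ Then for every $\lambda\in[0,\|\alpha\|_\infty^{-1}c_f^{-1})$ (with the convention $1/0=+\infty$), the only weak solution $(u,\phi)\in H^1(\mathbb{R}^3)\times\mathcal D^{1,2}(\mathbb{R}^3)$ of the system $$-\Delta u+u+e\phi u=\lambda\alpha(x)f(u)\ \text{in }\mathbb{R}^3,\qquad -\Delta\phi=4\pi e u^2\ \text{in }\mathbb{R}^3$$ is $(u,\phi)=(0,0)$.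
   Context: $H^1(\mathbb{R}^3)$ is the standard Sobolev space with norm $\|u\|_{H^1}=(\int_{\mathbb{R}^3}|\nabla u|^2+u^2)^{1/2}$. $\mathcal D^{1,2}(\mathbb{R}^3)$ is the completion of $C_0^\infty(\mathbb{R}^3)$ with respect to the norm $\|\phi\|_{\mathcal D^{1,2}}=(\int_{\mathbb{R}^3}|\nabla\phi|^2)^{1/2}$. A weak solution is a pair $(u,\phi)\in H^1(\mathbb{R}^3)\times\mathcal D^{1,2}(\mathbb{R}^3)$ such that $\int_{\mathbb{R}^3}(\nabla u\cdot\nabla v+uv+e\phi uv)=\lambda\int_{\mathbb{R}^3}\alpha(x)f(u)v$ for all $v\in H^1(\mathbb{R}^3)$ and $\int_{\mathbb{R}^3}\nabla\phi\cdot\nabla\psi=4\pi e\int_{\mathbb{R}^3}u^2\psi$ for all $\psi\in\mathcal D^{1,2}(\mathbb{R}^3)$. *)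

theory Defs
  imports "HOL-Analysis.Analysis" "HOL-Probability.Essential_Supremum"
begin

type_synonym R3 = "real ^ 3"

definition partial :: "3 \<Rightarrow> (R3 \<Rightarrow> real) \<Rightarrow> R3 \<Rightarrow> real" where
  "partial i g x = frechet_derivative g (at x) (axis i 1)"

definition grad :: "(R3 \<Rightarrow> real) \<Rightarrow> R3 \<Rightarrow> R3" where
  "grad g x = (\<chi> i. partial i g x)"

definition smooth3 :: "(R3 \<Rightarrow> real) \<Rightarrow> bool" where
  "smooth3 g \<longleftrightarrow> (\<forall>is :: 3 list. \<forall>x. foldr partial is g differentiable (at x))"

definition test_fun :: "(R3 \<Rightarrow> real) \<Rightarrow> bool" where
  "test_fun g \<longleftrightarrow> smooth3 g \<and> compact (closure {x. g x \<noteq> 0})"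

definition L2 :: "(R3 \<Rightarrow> real) \<Rightarrow> bool" where
  "L2 u \<longleftrightarrow> u \<in> borel_measurable lborel \<and> integrable lborel (\<lambda>x. (u x)\<^sup>2)"

definition L2vec :: "(R3 \<Rightarrow> R3) \<Rightarrow> bool" where
  "L2vec G \<longleftrightarrow> G \<in> borel_measurable lborel \<and> integrable lborel (\<lambda>x. (norm (G x))\<^sup>2)"

definition weak_grad :: "(R3 \<Rightarrow> real) \<Rightarrow> (R3 \<Rightarrow> R3) \<Rightarrow> bool" where
  "weak_grad u G \<longleftrightarrow>
     u \<in> borel_measurable lborel \<and> G \<in> borel_measurable lborel \<and>
     (\<forall>K. compact K \<longrightarrow> set_integrable lborel K u \<and> (\<forall>i. set_integrable lborel K (\<lambda>x. G x $ i))) \<and>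
     (\<forall>\<psi>. test_fun \<psi> \<longrightarrow> (\<forall>i.
        (\<integral>x. u x * partial i \<psi> x \<partial>lborel) = - (\<integral>x. G x $ i * \<psi> x \<partial>lborel)))"

definition H1_grad :: "(R3 \<Rightarrow> real) \<Rightarrow> (R3 \<Rightarrow> R3) \<Rightarrow> bool" where
  "H1_grad u G \<longleftrightarrow> L2 u \<and> weak_grad u G \<and> L2vec G"

text \<open>phi \<in> D^{1,2}(R^3) (completion of C_0^infinity w.r.t. the gradient L^2 norm) with weak
  gradient G: phi is the a.e. limit of test functions whose gradients converge to G in L^2.\<close>
definition D12_grad :: "(R3 \<Rightarrow> real) \<Rightarrow> (R3 \<Rightarrow> R3) \<Rightarrow> bool" where
  "D12_grad \<phi> G \<longleftrightarrow> weak_grad \<phi> G \<and> L2vec G \<and>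
     (\<exists>\<psi>s :: nat \<Rightarrow> R3 \<Rightarrow> real. (\<forall>n. test_fun (\<psi>s n)) \<and>
        (AE x in lborel. (\<lambda>n. \<psi>s n x) \<longlonglongrightarrow> \<phi> x) \<and>
        (\<lambda>n. \<integral>x. (norm (grad (\<psi>s n) x - G x))\<^sup>2 \<partial>lborel) \<longlonglongrightarrow> 0)"

definition weak_solution ::
  "real \<Rightarrow> real \<Rightarrow> (R3 \<Rightarrow> real) \<Rightarrow> (real \<Rightarrow> real) \<Rightarrow> (R3 \<Rightarrow> real) \<Rightarrow> (R3 \<Rightarrow> real) \<Rightarrow> bool" where
  "weak_solution e lam \<alpha> f u \<phi> \<longleftrightarrow>
     (\<exists>Gu G\<phi>. H1_grad u Gu \<and> D12_grad \<phi> G\<phi> \<and>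
       (\<forall>v Gv. H1_grad v Gv \<longrightarrow>
          (\<integral>x. Gu x \<bullet> Gv x + u x * v x + e * \<phi> x * u x * v x \<partial>lborel)
            = lam * (\<integral>x. \<alpha> x * f (u x) * v x \<partial>lborel)) \<and>
       (\<forall>\<psi> G\<psi>. D12_grad \<psi> G\<psi> \<longrightarrow>
          (\<integral>x. G\<phi> x \<bullet> G\<psi> x \<partial>lborel) = 4 * pi * e * (\<integral>x. (u x)\<^sup>2 * \<psi> x \<partial>lborel)))"

definition Linf :: "(R3 \<Rightarrow> real) \<Rightarrow> bool" where
  "Linf \<alpha> \<longleftrightarrow> \<alpha> \<in> borel_measurable lborel \<and> esssup lborel (\<lambda>x. ereal \<bar>\<alpha> x\<bar>) < \<infinity>"

definition norm_inf :: "(R3 \<Rightarrow> real) \<Rightarrow> real" where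
  "norm_inf \<alpha> = real_of_ereal (esssup lborel (\<lambda>x. ereal \<bar>\<alpha> x\<bar>))"

definition c_f :: "real \<Rightarrow> (real \<Rightarrow> real) \<Rightarrow> real" where
  "c_f e f = Sup ((\<lambda>s. \<bar>f s\<bar> / (\<bar>s\<bar> + 4 * sqrt pi * e * s\<^sup>2)) ` (UNIV - {0}))"

end

theory Submission
  imports Defs
begin

text \<open>
  Write \<open>I, J, K, Q\<close> for the integrals of \<open>\<bar>\<nabla>u\<bar>\<^sup>2, u\<^sup>2, \<bar>\<nabla>\<phi>\<bar>\<^sup>2, \<bar>u\<bar>\<^sup>3\<close>. Testing the first equation with
  \<open>u\<close> and the second with \<open>\<phi>\<close> gives \<open>I + J + K / (4\<pi>) = \<lambda> \<integral> \<alpha> f(u) u\<close>, and the right-hand side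
  is at most \<open>\<lambda> \<parallel>\<alpha>\<parallel>\<^sub>\<infinity> c\<^sub>f (J + 4 \<surd>\<pi> e Q)\<close>. Testing the second equation with \<open>\<bar>u\<bar>\<close> and applying
  \<open>a b \<le> a\<^sup>2 + b\<^sup>2 / 4\<close> gives \<open>4 \<surd>\<pi> e Q \<le> I + K / (4\<pi>)\<close>. Since
  \<open>\<lambda> \<parallel>\<alpha>\<parallel>\<^sub>\<infinity> c\<^sub>f < 1\<close>, all these integrals vanish.

  Instead of \<open>\<bar>u\<bar>\<close> itself, the second equation is tested with smoothed absolute values of
  mollified cut-offs of \<open>u\<close>; Fatou's lemma then gives the bound on \<open>Q\<close>. That \<open>\<nabla>\<phi> = 0\<close> forces
  \<open>\<phi> = 0\<close> follows from a weighted Hardy inequality for test functions.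
\<close>

section \<open>Smooth functions\<close>

text \<open>The constant 4 sqrt pi e in \<open>c_f\<close> comes from the splitting. Tested with
  |u|, the second equation reads 4 pi e Q = integral of grad phi . grad |u|. Dividing by sqrt pi and
  taking a = |grad u|, b = |grad phi| / sqrt pi bounds the right-hand side by I + K / (4 pi), with
  exactly the coefficients of the energy. So J + 4 sqrt pi e Q is at most the whole energy, with
  nothing to spare: every approximation of |u| has to keep the factor 1 in front of I in the limit.
  Two obstacles prevent a direct test with |u|. Membership in \<open>D12_grad\<close> asks for an
  approximating sequence of test functions, and |u|^3 is not known to be integrable, while the
  Bochner integral of a non-integrable function is 0 and would make the equation useless. Hence only
  test functions are inserted, where all integrals are finite, and Fatou's lemma for nonnegative
  integrals delivers finiteness and the bound together. A function with \<open>D12_grad\<close> need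
  not be in L2, and a vanishing gradient alone would allow constants; these are excluded through the
  approximating sequence.\<close>

lemma has_derivative_grad:
  assumes "g differentiable (at x)"
  shows "(g has_derivative (\<lambda>h. grad g x \<bullet> h)) (at x)"
proof -
  let ?D = "frechet_derivative g (at x)"
  have D: "(g has_derivative ?D) (at x)"
    using assms by (simp add: frechet_derivative_works)
  then have lin: "linear ?D"
    using has_derivative_linear by blast
  have "?D h = grad g x \<bullet> h" for h
  proof -
    have "?D h = ?D (\<Sum>i\<in>UNIV. h $ i *s axis i 1)"
      by (simp only: basis_expansion)
    also have "\<dots> = (\<Sum>i\<in>UNIV. h $ i * ?D (axis i 1))"
      by (simp add: linear_sum[OF lin] scalar_mult_eq_scaleR linear_cmul[OF lin])
    also have "\<dots> = grad g x \<bullet> h"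
      by (simp add: inner_vec_def grad_def partial_def mult.commute)
    finally show ?thesis .
  qed
  then have "?D = (\<lambda>h. grad g x \<bullet> h)" by auto
  with D show ?thesis by simp
qed

lemma partial_eqI:
  "(g has_derivative g') (at x) \<Longrightarrow> partial i g x = g' (axis i 1)"
  unfolding partial_def using frechet_derivative_at by metis

text \<open>\<open>smooth3\<close> is the largest class of differentiable functions stable under
  every \<open>partial i\<close>, so any stable class containing \<open>g\<close> is a certificate.
  The induction over lists of indices is done once, here.\<close>

lemma smooth3_coinduct:
  assumes "P g"
    and "\<And>g x. P g \<Longrightarrow> g differentiable (at x)"
    and "\<And>g i. P g \<Longrightarrow> P (partial i g)"
  shows "smooth3 g"
proof -
  have "P (foldr partial is g)" for "is"
    by (induction "is") (use assms in auto)
  then show ?thesis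
    unfolding smooth3_def using assms(2) by blast
qed

lemma smooth3_differentiable: "smooth3 g \<Longrightarrow> g differentiable (at x)"
  unfolding smooth3_def by (metis foldr_Nil id_apply)

lemma smooth3_partial: "smooth3 g \<Longrightarrow> smooth3 (partial i g)"
  by (rule smooth3_coinduct[where P = "\<lambda>h. \<exists>is. h = foldr partial is g"])
     (auto simp: smooth3_def intro: exI[of _ "[i]"] exI[of _ "_ # _"])

lemma smooth3_continuous: "smooth3 g \<Longrightarrow> continuous_on S g"
  by (simp add: continuous_at_imp_continuous_on differentiable_imp_continuous_within smooth3_differentiable)

text \<open>An invariant for \<open>smooth3_coinduct\<close>: the product rule turns one product
  into a sum of products, so a class stable under \<open>partial\<close> has to admit sums along
  with products. The generators \<open>B\<close> are chosen anew in each application.\<close>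

inductive_set generated_algebra :: "(R3 \<Rightarrow> real) set \<Rightarrow> (R3 \<Rightarrow> real) set" for B where
  base: "g \<in> B \<Longrightarrow> g \<in> generated_algebra B"
| const: "(\<lambda>x. c) \<in> generated_algebra B"
| add: "g \<in> generated_algebra B \<Longrightarrow> h \<in> generated_algebra B \<Longrightarrow> (\<lambda>x. g x + h x) \<in> generated_algebra B"
| mult: "g \<in> generated_algebra B \<Longrightarrow> h \<in> generated_algebra B \<Longrightarrow> (\<lambda>x. g x * h x) \<in> generated_algebra B"

lemma partial_add:
  assumes "g differentiable (at x)" "h differentiable (at x)"
  shows "partial i (\<lambda>x. g x + h x) x = partial i g x + partial i h x"
  using partial_eqI[OF has_derivative_add[OF has_derivative_grad has_derivative_grad], OF assms]
  by (simp add: inner_axis grad_def)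

lemma partial_mult:
  assumes "g differentiable (at x)" "h differentiable (at x)"
  shows "partial i (\<lambda>x. g x * h x) x = partial i g x * h x + g x * partial i h x"
  using partial_eqI[OF has_derivative_mult[OF has_derivative_grad has_derivative_grad], OF assms]
  by (simp add: inner_axis grad_def)

lemma partial_const: "partial i (\<lambda>x. c) = (\<lambda>x. 0)"
  by (rule ext, subst partial_eqI[OF has_derivative_const]) (rule refl)

text \<open>The Leibniz rule pushes \<open>partial\<close> down to the generators, whose partials
  need only lie in the algebra again, not in \<open>B\<close>.\<close>

lemma smooth3_alg:
  assumes "g \<in> generated_algebra B"
    and diff: "\<And>g x. g \<in> B \<Longrightarrow> g differentiable (at x)"
    and part: "\<And>g i. g \<in> B \<Longrightarrow> partial i g \<in> generated_algebra B"
  shows "smooth3 g"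
proof (rule smooth3_coinduct[where P = "\<lambda>g. g \<in> generated_algebra B"])
  show d: "g differentiable (at x)" if "g \<in> generated_algebra B" for g x
    using that by induction (auto intro: diff)
  show "partial i g \<in> generated_algebra B" if "g \<in> generated_algebra B" for g i
    using that
  proof induction
    case (const c)
    then show ?case by (simp add: partial_const generated_algebra.const)
  next
    case (add g h)
    have "partial i (\<lambda>x. g x + h x) = (\<lambda>x. partial i g x + partial i h x)"
      using add d by (auto intro!: partial_add)
    with add show ?case by (auto intro: generated_algebra.add)
  next
    case (mult g h)
    have "partial i (\<lambda>x. g x * h x) = (\<lambda>x. partial i g x * h x + g x * partial i h x)"
      using mult d by (auto intro!: partial_mult)
    with mult show ?case by (auto intro!: generated_algebra.add generated_algebra.mult)
  qed (use part in auto)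
qed (use assms in auto)

lemma smooth3_alg_smooth3: "g \<in> generated_algebra {g. smooth3 g} \<Longrightarrow> smooth3 g"
  by (erule smooth3_alg) (auto intro: smooth3_differentiable smooth3_partial generated_algebra.base)

lemma smooth3_const: "smooth3 (\<lambda>x. c)"
  by (rule smooth3_alg_smooth3) (rule generated_algebra.const)

lemma smooth3_add: "smooth3 g \<Longrightarrow> smooth3 h \<Longrightarrow> smooth3 (\<lambda>x. g x + h x)"
  by (intro smooth3_alg_smooth3 generated_algebra.add generated_algebra.base) auto

lemma smooth3_mult: "smooth3 g \<Longrightarrow> smooth3 h \<Longrightarrow> smooth3 (\<lambda>x. g x * h x)"
  by (intro smooth3_alg_smooth3 generated_algebra.mult generated_algebra.base) auto

lemma smooth3_power: "smooth3 g \<Longrightarrow> smooth3 (\<lambda>x. g x ^ n)"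
  by (induction n) (auto intro: smooth3_const smooth3_mult)

lemma smooth3_sum: "(\<And>j. j \<in> J \<Longrightarrow> smooth3 (g j)) \<Longrightarrow> smooth3 (\<lambda>x. \<Sum>j\<in>J. g j x)"
  by (induction J rule: infinite_finite_induct) (auto intro: smooth3_const smooth3_add)

lemma partial_component: "partial i (\<lambda>x. x $ j) = (\<lambda>x. if i = j then 1 else 0)"
proof
  fix x :: R3
  have "((\<lambda>x. x $ j) has_derivative (\<lambda>x. x $ j)) (at x)"
    by (simp add: bounded_linear_imp_has_derivative bounded_linear_vec_nth)
  from partial_eqI[OF this] show "partial i (\<lambda>x. x $ j) x = (if i = j then 1 else 0)"
    by (simp add: axis_def)
qed

lemma smooth3_component: "smooth3 (\<lambda>x. x $ j)"
proof (rule smooth3_alg[where B = "{\<lambda>x. x $ j}"])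
  show "g differentiable (at x)" if "g \<in> {\<lambda>x. x $ j}" for g x
    using that by (auto intro!: bounded_linear_imp_differentiable bounded_linear_vec_nth)
qed (auto simp: partial_component intro: generated_algebra.intros)

lemma smooth3_norm_power2: "smooth3 (\<lambda>x. (norm x)\<^sup>2)"
proof -
  have "(\<lambda>x::R3. (norm x)\<^sup>2) = (\<lambda>x. \<Sum>j\<in>UNIV. (x $ j)\<^sup>2)"
    by (auto simp: norm_vec_def L2_set_def sum_nonneg)
  then show ?thesis
    by (auto intro!: smooth3_sum smooth3_power smooth3_component)
qed

lemma partial_norm_power2: "partial i (\<lambda>x. (norm x)\<^sup>2) x = 2 * x $ i"
proof -
  have "((\<lambda>x. x \<bullet> x) has_derivative (\<lambda>h. x \<bullet> h + h \<bullet> x)) (at x)"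
    by (auto intro!: derivative_eq_intros)
  from partial_eqI[OF this] show ?thesis
    by (simp add: power2_norm_eq_inner inner_axis inner_commute)
qed

lemma grad_comp:
  assumes "(\<rho> has_real_derivative d) (at (g x))" "g differentiable (at x)"
  shows "((\<lambda>x. \<rho> (g x)) has_derivative (\<lambda>h. d * (grad g x \<bullet> h))) (at x)"
  using has_derivative_compose[OF has_derivative_grad[OF assms(2)], of \<rho> "(*) d"] assms(1)
  by (simp add: has_field_derivative_def)

lemma partial_comp:
  assumes "(\<rho> has_real_derivative d) (at (g x))" "g differentiable (at x)"
  shows "partial i (\<lambda>x. \<rho> (g x)) x = d * partial i g x"
  using partial_eqI[OF grad_comp[OF assms]] by (simp add: inner_axis grad_def)

text \<open>It suffices that the scalar functions form a family stable under differentiation up to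
  smooth factors, so no Faa di Bruno formula is needed.\<close>
lemma smooth3_comp:
  assumes g: "smooth3 g" "\<rho> \<in> S"
    and S: "\<And>\<rho>. \<rho> \<in> S \<Longrightarrow>
      \<exists>a\<in>S. \<exists>b\<in>S. \<exists>p q. \<forall>x. (\<rho> has_real_derivative p * a (g x) + q * b (g x)) (at (g x))"
  shows "smooth3 (\<lambda>x. \<rho> (g x))"
proof -
  \<comment> \<open>The chain rule produces the factor \<open>partial i g\<close>, so all smooth
    functions serve as generators next to the compositions with \<open>S\<close>.\<close>
  let ?B = "{h. smooth3 h} \<union> (\<lambda>\<rho> x. \<rho> (g x)) ` S"
  show ?thesis
  proof (rule smooth3_alg[where B = ?B])
    show "(\<lambda>x. \<rho> (g x)) \<in> generated_algebra ?B"
      using g by (intro generated_algebra.base) auto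
    show "h differentiable (at x)" if "h \<in> ?B" for h x
    proof -
      { fix \<sigma> assume "\<sigma> \<in> S"
        then obtain d where "(\<sigma> has_real_derivative d) (at (g x))"
          using S by blast
        from grad_comp[OF this smooth3_differentiable[OF g(1)]]
        have "(\<lambda>x. \<sigma> (g x)) differentiable (at x)"
          by (auto simp: differentiable_def) }
      with that show ?thesis by (auto intro: smooth3_differentiable)
    qed
    show "partial i h \<in> generated_algebra ?B" if "h \<in> ?B" for h i
    proof -
      { fix \<sigma> assume "\<sigma> \<in> S"
        then obtain a b p q where ab: "a \<in> S" "b \<in> S"
          and d: "\<And>x. (\<sigma> has_real_derivative p * a (g x) + q * b (g x)) (at (g x))"
          using S by blast
        have "partial i (\<lambda>x. \<sigma> (g x)) = (\<lambda>x. (p * a (g x) + q * b (g x)) * partial i g x)"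
          using partial_comp[OF d smooth3_differentiable[OF g(1)]] by auto
        also have "\<dots> \<in> generated_algebra ?B"
          using ab g by (intro generated_algebra.mult generated_algebra.add generated_algebra.const generated_algebra.base) (auto intro: smooth3_partial)
        finally have "partial i (\<lambda>x. \<sigma> (g x)) \<in> generated_algebra ?B" . }
      with that show ?thesis by (auto intro: generated_algebra.base smooth3_partial)
    qed
  qed
qed

section \<open>Test functions\<close>

text \<open>Differentiating exp (- 1 / t) / t ^ k gives the same expression with exponents k + 1 and
  k + 2. Indexing by \<open>k\<close> thus yields a family stable under differentiation, as
  \<open>smooth3_comp\<close> asks; the bump itself is built from \<open>flat 0\<close>.\<close>

definition flat :: "nat \<Rightarrow> real \<Rightarrow> real" where
  "flat k t = (if t > 0 then exp (- 1 / t) / t ^ k else 0)"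

text \<open>This is the difference quotient of \<open>flat k\<close> at 0, the one point where the
  derivative is not given by a formula nearby. Substituting y = 1 / t turns the limit from the right
  into that of y ^ (k + 1) / exp y.\<close>

lemma flat_over_tendsto_0: "((\<lambda>t. flat k t / t) \<longlongrightarrow> 0) (at 0)"
proof -
  have "((\<lambda>y::real. y ^ Suc k / exp y) \<longlongrightarrow> 0) at_top"
    by (rule tendsto_power_div_exp_0)
  then have "((\<lambda>t::real. inverse t ^ Suc k / exp (inverse t)) \<longlongrightarrow> 0) (at_right 0)"
    by (rule filterlim_compose) (rule filterlim_inverse_at_top_right)
  then have "((\<lambda>t. flat k t / t) \<longlongrightarrow> 0) (at_right 0)"
  proof (rule Lim_transform_eventually)
    show "\<forall>\<^sub>F t in at_right 0. inverse t ^ Suc k / exp (inverse t) = flat k t / t"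
      using eventually_at_right_less[of 0]
      by eventually_elim (auto simp: flat_def field_simps exp_minus)
  qed
  moreover have "((\<lambda>t. flat k t / t) \<longlongrightarrow> 0) (at_left 0)"
  proof (rule Lim_transform_eventually[OF tendsto_const])
    show "\<forall>\<^sub>F t in at_left 0. 0 = flat k t / t"
      unfolding eventually_at_left_field by (auto simp: flat_def intro!: exI[of _ "-1"])
  qed
  ultimately show ?thesis
    by (simp add: filterlim_split_at)
qed

lemma has_real_derivative_flat:
  "(flat k has_real_derivative - real k * flat (Suc k) t + 1 * flat (Suc (Suc k)) t) (at t)"
proof (cases t "0::real" rule: linorder_cases)
  case less
  have "((\<lambda>_. 0) has_real_derivative 0) (at t)" by simp
  then have "(flat k has_real_derivative 0) (at t)"
    by (rule has_field_derivative_transform_within_open[of _ _ _ "{..<0}"])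
       (use less in \<open>auto simp: flat_def\<close>)
  with less show ?thesis by (simp add: flat_def)
next
  case equal
  then show ?thesis
    using flat_over_tendsto_0[of k] by (simp add: flat_def has_field_derivative_iff)
next
  case greater
  have "((\<lambda>t. exp (- 1 / t) / t ^ k) has_real_derivative
      - real k * flat (Suc k) t + 1 * flat (Suc (Suc k)) t) (at t)"
  \<comment> \<open>Differentiating t ^ k yields the natural-number exponent \<open>k - 1\<close>,
    hence the split.\<close>
  proof (cases k)
    case (Suc m)
    then show ?thesis
      using greater
      by (auto intro!: derivative_eq_intros simp: flat_def field_simps power2_eq_square)
         (metis One_nat_def mult.commute neq0_conv power_minus_mult)
  qed (use greater in \<open>auto intro!: derivative_eq_intros simp: flat_def field_simps power2_eq_square\<close>)
  then show ?thesis
    by (rule has_field_derivative_transform_within_open[of _ _ _ "{0<..}"])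
       (use greater in \<open>auto simp: flat_def\<close>)
qed

definition bump :: "R3 \<Rightarrow> real" where
  "bump x = flat 0 (1 - (norm x)\<^sup>2)"

lemma smooth3_diff: "smooth3 g \<Longrightarrow> smooth3 h \<Longrightarrow> smooth3 (\<lambda>x. g x - h x)"
  using smooth3_add[of g "\<lambda>x. (-1) * h x"] smooth3_mult[OF smooth3_const, of h "-1"] by simp

lemma smooth3_bump: "smooth3 bump"
  unfolding bump_def[abs_def]
proof (rule smooth3_comp[where S = "range flat" and \<rho> = "flat 0" and g = "\<lambda>x. 1 - (norm x)\<^sup>2"])
  show "smooth3 (\<lambda>x. 1 - (norm x)\<^sup>2)"
    by (intro smooth3_diff smooth3_const smooth3_norm_power2)
  show "\<exists>a\<in>range flat. \<exists>b\<in>range flat. \<exists>p q. \<forall>x.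
      (\<rho> has_real_derivative p * a (1 - (norm x)\<^sup>2) + q * b (1 - (norm x)\<^sup>2)) (at (1 - (norm x)\<^sup>2))"
    if "\<rho> \<in> range flat" for \<rho>
    using that has_real_derivative_flat by blast
qed auto

lemma bump_nonneg: "bump x \<ge> 0"
  and bump_le: "bump x \<le> bump 0"
  and bump_0: "bump 0 > 0"
  and bump_eq_0: "norm x \<ge> 1 \<Longrightarrow> bump x = 0"
proof -
  show "bump x \<le> bump 0"
    by (auto simp: bump_def flat_def field_simps)
  show "norm x \<ge> 1 \<Longrightarrow> bump x = 0"
    using one_le_power[of "norm x" 2] unfolding bump_def flat_def by (metis diff_gt_0_iff_gt linorder_not_le)
qed (auto simp: bump_def flat_def)

section \<open>Closure properties of test functions\<close>

lemma test_fun_iff: "test_fun g \<longleftrightarrow> smooth3 g \<and> bounded {x. g x \<noteq> 0}"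
  by (simp add: test_fun_def compact_closure)

lemma test_funD: "test_fun g \<Longrightarrow> smooth3 g" "test_fun g \<Longrightarrow> bounded {x. g x \<noteq> 0}"
  by (simp_all add: test_fun_iff)

lemma test_fun_bump: "test_fun bump"
proof -
  have "{x. bump x \<noteq> 0} \<subseteq> cball 0 1"
    using bump_eq_0 by force
  then show ?thesis
    using smooth3_bump bounded_subset[OF bounded_cball] by (auto simp: test_fun_iff)
qed

lemma test_fun_mult: "smooth3 g \<Longrightarrow> test_fun h \<Longrightarrow> test_fun (\<lambda>x. g x * h x)"
  unfolding test_fun_iff using smooth3_mult[of g h]
  by (auto elim!: bounded_subset)

text \<open>Off the closure of its support, \<open>g\<close> vanishes on an open set, so its
  derivative vanishes there too; the closure of a bounded set is bounded.\<close>

lemma test_fun_partial: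
  assumes "test_fun g" shows "test_fun (partial i g)"
proof -
  have "{x. partial i g x \<noteq> 0} \<subseteq> closure {x. g x \<noteq> 0}"
  proof (rule subsetI, rule ccontr)
    fix x assume x: "x \<in> {x. partial i g x \<noteq> 0}" "x \<notin> closure {x. g x \<noteq> 0}"
    have "((\<lambda>_. 0) has_derivative (\<lambda>_. 0)) (at x)" by simp
    then have "(g has_derivative (\<lambda>_. 0)) (at x)"
      by (rule has_derivative_transform_within_open[where s = "- closure {x. g x \<noteq> 0}"])
         (use x closure_subset[of "{x. g x \<noteq> 0}"] in auto)
    from partial_eqI[OF this] x show False by auto
  qed
  with assms show ?thesis
    unfolding test_fun_iff by (auto intro: smooth3_partial bounded_subset[OF bounded_closure])
qed

lemma partial_affine:
  assumes "h differentiable (at (a + c *\<^sub>R x))"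
  shows "partial i (\<lambda>x. h (a + c *\<^sub>R x)) x = c * partial i h (a + c *\<^sub>R x)"
    and "(\<lambda>x. h (a + c *\<^sub>R x)) differentiable (at x)"
proof -
  have "((\<lambda>x. a + c *\<^sub>R x) has_derivative (\<lambda>k. c *\<^sub>R k)) (at x)"
    by (auto intro!: derivative_eq_intros)
  from has_derivative_compose[OF this has_derivative_grad[OF assms]]
  have d: "((\<lambda>x. h (a + c *\<^sub>R x)) has_derivative
      (\<lambda>k. grad h (a + c *\<^sub>R x) \<bullet> c *\<^sub>R k)) (at x)" .
  from partial_eqI[OF d] show "partial i (\<lambda>x. h (a + c *\<^sub>R x)) x = c * partial i h (a + c *\<^sub>R x)"
    by (simp add: inner_axis grad_def)
  from d show "(\<lambda>x. h (a + c *\<^sub>R x)) differentiable (at x)"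
    by (auto simp: differentiable_def)
qed

lemma smooth3_affine:
  assumes "smooth3 h" shows "smooth3 (\<lambda>x. h (a + c *\<^sub>R x))"
proof -
  let ?B = "(\<lambda>h x. h (a + c *\<^sub>R x)) ` {h. smooth3 h}"
  show ?thesis
  proof (rule smooth3_alg[where B = ?B])
    show "(\<lambda>x. h (a + c *\<^sub>R x)) \<in> generated_algebra ?B"
      using assms by (intro generated_algebra.base) auto
    show "g differentiable (at x)" if "g \<in> ?B" for g x
      using that by (auto intro: partial_affine(2)[OF smooth3_differentiable])
    show "partial i g \<in> generated_algebra ?B" if "g \<in> ?B" for g i
    proof -
      obtain k where k: "smooth3 k" "g = (\<lambda>x. k (a + c *\<^sub>R x))"
        using \<open>g \<in> ?B\<close> by blast
      have "partial i g = (\<lambda>x. c * partial i k (a + c *\<^sub>R x))"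
        using k by (auto intro: partial_affine(1)[OF smooth3_differentiable])
      also have "\<dots> \<in> generated_algebra ?B"
        using k by (intro generated_algebra.mult generated_algebra.const generated_algebra.base) (auto intro: smooth3_partial)
      finally show ?thesis .
    qed
  qed
qed

text \<open>Used with \<open>a = 0\<close> to shrink or stretch a bump, and with
  \<open>c = -1\<close> for the reflected translate y -> x - y inside a convolution.\<close>

lemma test_fun_affine:
  assumes "test_fun h" "c \<noteq> 0" shows "test_fun (\<lambda>x. h (a + c *\<^sub>R x))"
proof -
  have "{x. h (a + c *\<^sub>R x) \<noteq> 0} \<subseteq> (\<lambda>y. (1 / c) *\<^sub>R y) ` ((\<lambda>y. - a + y) ` {x. h x \<noteq> 0})"
    using assms(2) by (auto simp: image_iff intro!: exI[of _ "a + c *\<^sub>R _"])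
  moreover have "bounded ((\<lambda>y. (1 / c) *\<^sub>R y) ` ((\<lambda>y. - a + y) ` {x. h x \<noteq> 0}))"
    using assms(1) by (intro bounded_scaling bounded_translation) (simp add: test_fun_iff)
  ultimately show ?thesis
    using assms unfolding test_fun_iff by (auto intro: smooth3_affine bounded_subset)
qed

text \<open>All real powers together are stable under differentiation up to constants; the second
  slot of \<open>smooth3_comp\<close> gets the coefficient 0. Exponent -1 gives the weight in the
  Hardy inequality, exponent 1/2 the smoothed absolute value.\<close>

lemma smooth3_powr:
  assumes "smooth3 g" "\<And>x. g x > 0" shows "smooth3 (\<lambda>x. g x powr a)"
proof (rule smooth3_comp[where S = "range (\<lambda>a t. t powr a)" and \<rho> = "\<lambda>t. t powr a"])
  fix \<rho> assume "\<rho> \<in> range (\<lambda>a t::real. t powr a)"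
  then obtain b where b: "\<rho> = (\<lambda>t. t powr b)" by auto
  have "(\<rho> has_real_derivative b * (g x powr (b - 1)) + 0 * (g x powr 0)) (at (g x))" for x
    unfolding b using assms(2)[of x] has_real_derivative_powr[of "g x" b] by simp
  then show "\<exists>a\<in>range (\<lambda>a t. t powr a). \<exists>b\<in>range (\<lambda>a t. t powr a). \<exists>p q.
      \<forall>x. (\<rho> has_real_derivative p * a (g x) + q * b (g x)) (at (g x))"
    by (intro bexI[of _ "\<lambda>t. t powr (b - 1)"] bexI[of _ "\<lambda>t. t powr 0"]
        exI[of _ b] exI[of _ 0]) auto
qed (use assms in auto)

section \<open>Integrability, measurability and uniform bounds for test functions\<close>

lemma integrable_bounded_support:
  fixes g :: "R3 \<Rightarrow> real"
  assumes "continuous_on UNIV g" "bounded {x. g x \<noteq> 0}"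
  shows "integrable lborel g"
proof -
  have "integrable lborel (\<lambda>x. indicator (closure {x. g x \<noteq> 0}) x *\<^sub>R g x)"
    using assms by (intro borel_integrable_compact) (auto simp: compact_closure intro: continuous_on_subset)
  also have "(\<lambda>x. indicator (closure {x. g x \<noteq> 0}) x *\<^sub>R g x) = g"
    using closure_subset[of "{x. g x \<noteq> 0}"] by (auto simp: indicator_def fun_eq_iff)
  finally show ?thesis .
qed

lemma bounded_support_bounded:
  fixes g :: "R3 \<Rightarrow> real"
  assumes "continuous_on UNIV g" "bounded {x. g x \<noteq> 0}"
  obtains M where "M \<ge> 0" "\<And>x. \<bar>g x\<bar> \<le> M"
proof -
  have "compact (g ` closure {x. g x \<noteq> 0})"
    using assms by (intro compact_continuous_image) (auto simp: compact_closure intro: continuous_on_subset)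
  then have "bounded (g ` closure {x. g x \<noteq> 0})"
    by (rule compact_imp_bounded)
  then obtain M where M: "\<And>x. x \<in> closure {x. g x \<noteq> 0} \<Longrightarrow> \<bar>g x\<bar> \<le> M"
    by (auto simp: bounded_iff)
  have "\<bar>g x\<bar> \<le> max 0 M" for x
    using M[of x] closure_subset[of "{x. g x \<noteq> 0}"] by (cases "g x = 0") auto
  then show ?thesis by (auto intro: that[of "max 0 M"])
qed

lemma test_fun_integrable: "test_fun g \<Longrightarrow> integrable lborel g"
  by (auto intro!: integrable_bounded_support smooth3_continuous simp: test_fun_iff)

lemma test_fun_bounded:
  assumes "test_fun g" obtains M where "M \<ge> 0" "\<And>x. \<bar>g x\<bar> \<le> M"
  using bounded_support_bounded[of g] assms by (auto intro!: smooth3_continuous simp: test_fun_iff)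

lemma smooth3_measurable [measurable_dest]: "smooth3 g \<Longrightarrow> g \<in> borel_measurable borel"
  by (simp add: borel_measurable_continuous_onI smooth3_continuous)

lemma measurable_grad: "smooth3 g \<Longrightarrow> grad g \<in> borel_measurable borel"
proof -
  assume "smooth3 g"
  then have "continuous_on UNIV (\<lambda>x. \<chi> i. partial i g x)"
    by (intro continuous_on_vec_lambda smooth3_continuous smooth3_partial)
  then show ?thesis
    by (simp add: grad_def[abs_def] borel_measurable_continuous_onI)
qed

lemma norm_grad_power2: "(norm (grad g x))\<^sup>2 = (\<Sum>i\<in>UNIV. (partial i g x)\<^sup>2)"
  by (simp add: norm_vec_def L2_set_def sum_nonneg grad_def)

lemma test_fun_grad_bounded:
  assumes "test_fun g" obtains M where "M \<ge> 0" "\<And>x. norm (grad g x) \<le> M"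
proof -
  have "\<exists>M. M \<ge> 0 \<and> (\<forall>x. \<bar>partial i g x\<bar> \<le> M)" for i
    using test_fun_bounded[OF test_fun_partial[OF assms]] by metis
  then obtain M where M: "\<And>i. M i \<ge> 0" "\<And>i x. \<bar>partial i g x\<bar> \<le> M i"
    by metis
  have "norm (grad g x) \<le> (\<Sum>i\<in>UNIV. M i)" for x
  proof -
    have "norm (grad g x) \<le> (\<Sum>i\<in>UNIV. \<bar>grad g x $ i\<bar>)" by (rule norm_le_l1_cart)
    also have "\<dots> \<le> (\<Sum>i\<in>UNIV. M i)" by (rule sum_mono) (simp add: grad_def M)
    finally show ?thesis .
  qed
  then show ?thesis
    using M(1) by (intro that[of "\<Sum>i\<in>UNIV. M i"]) (auto intro: sum_nonneg)
qed

lemma test_fun_lipschitz: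
  assumes "test_fun g" "\<And>x. norm (grad g x) \<le> M"
  shows "\<bar>g y - g x\<bar> \<le> M * norm (y - x)"
proof -
  have "norm (g y - g x) \<le> M * norm (y - x)"
  proof (rule differentiable_bound[where S = UNIV and f' = "\<lambda>x h. grad g x \<bullet> h"])
    show "(g has_derivative (\<lambda>h. grad g x \<bullet> h)) (at x within UNIV)" for x
      using assms(1) by (auto intro!: has_derivative_grad smooth3_differentiable simp: test_fun_iff)
    show "onorm ((\<bullet>) (grad g x)) \<le> M" for x
    proof (rule onorm_le)
      fix h
      show "norm (grad g x \<bullet> h) \<le> M * norm h"
        using Cauchy_Schwarz_ineq2[of "grad g x" h] mult_right_mono[OF assms(2)[of x] norm_ge_zero[of h]]
        by simp
    qed
  qed auto
  then show ?thesis by simp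
qed

section \<open>Integration by parts and a Hardy inequality\<close>

text \<open>\<open>s = 1\<close> covers translations and \<open>s = -1\<close> the substitution y ->
  x - y, the two changes of variable that convolutions need.\<close>

lemma lborel_affine_unit:
  fixes a :: R3 and s :: real
  assumes "\<bar>s\<bar> = 1"
  shows "distr lborel borel (\<lambda>x. a + s *\<^sub>R x) = lborel"
  using lborel_affine[of s a] assms by (auto simp: density_1)

lemma nn_integral_affine_unit:
  fixes f :: "R3 \<Rightarrow> ennreal" and a :: R3 and s :: real
  assumes [measurable]: "f \<in> borel_measurable borel" and s: "\<bar>s\<bar> = 1"
  shows "(\<integral>\<^sup>+x. f (a + s *\<^sub>R x) \<partial>lborel) = (\<integral>\<^sup>+x. f x \<partial>lborel)"
proof -
  have "(\<integral>\<^sup>+x. f x \<partial>lborel) = (\<integral>\<^sup>+x. f x \<partial>distr lborel borel (\<lambda>x. a + s *\<^sub>R x))"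
    by (simp add: lborel_affine_unit[OF s])
  also have "\<dots> = (\<integral>\<^sup>+x. f (a + s *\<^sub>R x) \<partial>lborel)"
    by (rule nn_integral_distr) auto
  finally show ?thesis ..
qed

lemma
  fixes f :: "R3 \<Rightarrow> real" and a :: R3 and s :: real
  assumes [measurable]: "f \<in> borel_measurable borel" and s: "\<bar>s\<bar> = 1"
  shows integral_affine_unit: "(\<integral>x. f (a + s *\<^sub>R x) \<partial>lborel) = (\<integral>x. f x \<partial>lborel)"
    and integrable_affine_unit: "integrable lborel (\<lambda>x. f (a + s *\<^sub>R x)) \<longleftrightarrow> integrable lborel f"
proof -
  have "(\<integral>x. f x \<partial>lborel) = (\<integral>x. f x \<partial>distr lborel borel (\<lambda>x. a + s *\<^sub>R x))"
    by (simp add: lborel_affine_unit[OF s])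
  also have "\<dots> = (\<integral>x. f (a + s *\<^sub>R x) \<partial>lborel)"
    by (rule integral_distr) auto
  finally show "(\<integral>x. f (a + s *\<^sub>R x) \<partial>lborel) = (\<integral>x. f x \<partial>lborel)" ..
  have "integrable lborel f \<longleftrightarrow> integrable (distr lborel borel (\<lambda>x. a + s *\<^sub>R x)) f"
    by (simp add: lborel_affine_unit[OF s])
  also have "\<dots> \<longleftrightarrow> integrable lborel (\<lambda>x. f (a + s *\<^sub>R x))"
    by (rule integrable_distr_eq) auto
  finally show "integrable lborel (\<lambda>x. f (a + s *\<^sub>R x)) \<longleftrightarrow> integrable lborel f" ..
qed

text \<open>Translation invariance makes the integral of every difference quotient vanish.\<close>
lemma integral_partial_test_fun:
  assumes \<psi>: "test_fun \<psi>" shows "(\<integral>x. partial i \<psi> x \<partial>lborel) = 0"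
proof -
  obtain R where R: "\<And>x. \<psi> x \<noteq> 0 \<Longrightarrow> norm x \<le> R"
    using test_funD(2)[OF \<psi>] by (auto simp: bounded_iff)
  obtain M where M: "M \<ge> 0" "\<And>x. norm (grad \<psi> x) \<le> M"
    using test_fun_grad_bounded[OF \<psi>] by metis
  have [measurable]: "\<psi> \<in> borel_measurable borel" "partial i \<psi> \<in> borel_measurable borel"
    using test_funD(1)[OF \<psi>] by (auto intro!: smooth3_measurable smooth3_partial)
  define t :: "nat \<Rightarrow> real" where "t n = 1 / real (Suc n)" for n
  have t: "t n > 0" "t n \<le> 1" for n by (auto simp: t_def)
  have t0: "t \<longlonglongrightarrow> 0" unfolding t_def[abs_def] by (rule LIMSEQ_Suc) (rule lim_1_over_n)
  let ?q = "\<lambda>n x. (\<psi> (t n *\<^sub>R axis i 1 + x) - \<psi> x) / t n"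
  have "(\<lambda>n. \<integral>x. ?q n x \<partial>lborel) \<longlonglongrightarrow> (\<integral>x. partial i \<psi> x \<partial>lborel)"
  \<comment> \<open>The gradient bound \<open>M\<close> dominates the quotients, and as the steps
    \<open>t n\<close> are at most 1, the shifted supports stay in the ball of radius
    \<open>R + 1\<close>.\<close>
  proof (rule integral_dominated_convergence[where w = "\<lambda>x. M * indicator (cball 0 (R + 1)) x"])
    show "integrable lborel (\<lambda>x::R3. M * indicator (cball 0 (R + 1)) x)"
      using emeasure_bounded_finite[OF bounded_cball]
      by (intro integrable_mult_right integrable_real_indicator) auto
    show "AE x in lborel. (\<lambda>n. ?q n x) \<longlonglongrightarrow> partial i \<psi> x"
    proof (rule AE_I2)
      fix x :: R3
      have "((\<lambda>s. x + s *\<^sub>R axis i 1) has_derivative (\<lambda>s. s *\<^sub>R axis i 1)) (at 0)"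
        by (auto intro!: derivative_eq_intros)
      from has_derivative_compose[OF this, of \<psi> "\<lambda>h. grad \<psi> x \<bullet> h"]
      have "((\<lambda>s. \<psi> (x + s *\<^sub>R axis i 1)) has_derivative (\<lambda>s. grad \<psi> x \<bullet> (s *\<^sub>R axis i 1))) (at 0)"
        using has_derivative_grad[OF smooth3_differentiable[OF test_funD(1)[OF \<psi>]], of x] by simp
      then have "((\<lambda>s. \<psi> (x + s *\<^sub>R axis i 1)) has_real_derivative partial i \<psi> x) (at 0)"
        by (simp add: has_field_derivative_def inner_axis grad_def mult.commute[of _ "partial i \<psi> x"] mult_commute_abs)
      then have "((\<lambda>s. (\<psi> (x + s *\<^sub>R axis i 1) - \<psi> x) / s) \<longlongrightarrow> partial i \<psi> x) (at 0)"
        by (simp add: has_field_derivative_iff)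
      then have "(\<lambda>n. (\<psi> (x + t n *\<^sub>R axis i 1) - \<psi> x) / t n) \<longlonglongrightarrow> partial i \<psi> x"
        using t0 t(1) by (auto simp: tendsto_at_iff_sequentially o_def less_imp_neq[symmetric])
      then show "(\<lambda>n. ?q n x) \<longlonglongrightarrow> partial i \<psi> x"
        by (simp add: add.commute)
    qed
    show "AE x in lborel. norm (?q n x) \<le> M * indicator (cball 0 (R + 1)) x" for n
    proof (rule AE_I2)
      fix x
      show "norm (?q n x) \<le> M * indicator (cball 0 (R + 1)) x"
      proof (cases "x \<in> cball 0 (R + 1)")
        case True
        have "\<bar>\<psi> (t n *\<^sub>R axis i 1 + x) - \<psi> x\<bar> \<le> M * t n"
          using test_fun_lipschitz[OF \<psi> M(2), of "t n *\<^sub>R axis i 1 + x" x] t(1)[of n]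
          by (simp add: norm_axis_1)
        with True t(1)[of n] show ?thesis by (simp add: field_simps)
      next
        case False
        then have "norm x > R + 1" by simp
        moreover have "norm (t n *\<^sub>R axis i 1 + x) \<ge> norm x - 1"
          using norm_diff_ineq[of x "t n *\<^sub>R axis i 1"] t[of n] by (simp add: add.commute norm_axis_1)
        ultimately have "\<psi> x = 0" "\<psi> (t n *\<^sub>R axis i 1 + x) = 0"
          using R[of x] R[of "t n *\<^sub>R axis i 1 + x"] by force+
        then show ?thesis by (simp add: M(1))
      qed
    qed
  qed auto
  moreover have "(\<integral>x. ?q n x \<partial>lborel) = 0" for n
    using integral_affine_unit[of \<psi> 1 "t n *\<^sub>R axis i 1"] integrable_affine_unit[of \<psi> 1 "t n *\<^sub>R axis i 1"]
      test_fun_integrable[OF \<psi>] by simp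
  ultimately show ?thesis
    by (simp only: LIMSEQ_const_iff)
qed

lemma integral_by_parts_test_fun:
  assumes "smooth3 g" "test_fun h"
  shows "(\<integral>x. g x * partial i h x \<partial>lborel) = - (\<integral>x. partial i g x * h x \<partial>lborel)"
proof -
  have "partial i (\<lambda>x. g x * h x) = (\<lambda>x. partial i g x * h x + g x * partial i h x)"
    using assms test_funD by (auto intro!: partial_mult smooth3_differentiable)
  then have "(\<integral>x. partial i g x * h x + g x * partial i h x \<partial>lborel) = 0"
    using integral_partial_test_fun[OF test_fun_mult[OF assms], of i] by simp
  moreover have "integrable lborel (\<lambda>x. partial i g x * h x)" "integrable lborel (\<lambda>x. g x * partial i h x)"
    using assms by (auto intro!: test_fun_integrable test_fun_mult smooth3_partial test_fun_partial)
  ultimately show ?thesis by simp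
qed

lemma norm_power2_R3: "(norm (x :: R3))\<^sup>2 = (\<Sum>i\<in>UNIV. (x $ i)\<^sup>2)"
  by (simp add: norm_vec_def L2_set_def sum_nonneg)

lemma integrable_grad_power2: "test_fun \<psi> \<Longrightarrow> integrable lborel (\<lambda>x. (norm (grad \<psi> x))\<^sup>2)"
  unfolding norm_grad_power2 unfolding power2_eq_square
  by (intro Bochner_Integration.integrable_sum test_fun_integrable test_fun_mult)
     (auto intro: smooth3_partial test_fun_partial test_funD)

text \<open>Makes every test function admissible in the second equation; the constant sequence
  approximates it.\<close>

lemma D12_grad_test_fun:
  assumes "test_fun \<psi>" shows "D12_grad \<psi> (grad \<psi>)"
proof -
  note s = test_funD(1)[OF assms]
  have "set_integrable lborel K g" if "smooth3 g" "compact K" for g K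
    unfolding set_integrable_def using that by (intro borel_integrable_compact smooth3_continuous)
  then have "weak_grad \<psi> (grad \<psi>)"
    unfolding weak_grad_def
    using s by (auto simp: grad_def[of _ "_"] smooth3_partial integral_by_parts_test_fun intro: smooth3_measurable measurable_grad)
  moreover have "L2vec (grad \<psi>)"
    unfolding L2vec_def using integrable_grad_power2[OF assms] measurable_grad[OF s] by simp
  ultimately show ?thesis
    unfolding D12_grad_def using assms by (auto intro!: exI[of _ "\<lambda>_. \<psi>"])
qed

text \<open>For \<open>F x = x / (1 + \<bar>x\<bar>\<^sup>2)\<close> one has \<open>div F - \<bar>F\<bar>\<^sup>2 = 3 / (1 + \<bar>x\<bar>\<^sup>2)\<^sup>2\<close>, and
  the claim is \<open>0 \<le> \<integral> \<bar>\<nabla>\<psi> + \<psi> F\<bar>\<^sup>2\<close> integrated by parts.\<close>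
lemma hardy_test_fun:
  assumes \<psi>: "test_fun \<psi>"
  shows "integrable lborel (\<lambda>x. 3 * (\<psi> x)\<^sup>2 / (1 + (norm x)\<^sup>2)\<^sup>2)"
    and "(\<integral>x. 3 * (\<psi> x)\<^sup>2 / (1 + (norm x)\<^sup>2)\<^sup>2 \<partial>lborel) \<le> (\<integral>x. (norm (grad \<psi> x))\<^sup>2 \<partial>lborel)"
proof -
  \<comment> \<open>Written as a real power so that \<open>smooth3_powr\<close> applies.\<close>
  define w :: "R3 \<Rightarrow> real" where "w x = (1 + (norm x)\<^sup>2) powr - 1" for x
  have pos: "1 + (norm x)\<^sup>2 > 0" for x :: R3
    by (simp add: add_pos_nonneg)
  have w: "w x = 1 / (1 + (norm x)\<^sup>2)" for x
    using pos[of x] by (simp add: w_def powr_minus_divide)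
  have sw: "smooth3 w"
    unfolding w_def[abs_def] using pos by (intro smooth3_powr smooth3_add smooth3_const smooth3_norm_power2)
  have pw: "partial i w x = - 2 * x $ i * (w x)\<^sup>2" for i x
  proof -
    have "((\<lambda>t. 1 / (1 + t)) has_real_derivative - (w x)\<^sup>2) (at ((norm x)\<^sup>2))"
      using pos[of x] by (auto intro!: derivative_eq_intros simp: w power2_eq_square)
    from partial_comp[OF this smooth3_differentiable[OF smooth3_norm_power2]]
    show ?thesis by (simp add: w[abs_def] partial_norm_power2)
  qed
  have s\<psi>: "smooth3 \<psi>" using \<psi> by (rule test_funD)
  define F where "F i x = x $ i * w x" for i and x :: R3
  have sF: "smooth3 (F i)" for i
    unfolding F_def[abs_def] by (intro smooth3_mult smooth3_component sw)
  have pF: "partial i (F i) x = w x - 2 * (x $ i)\<^sup>2 * (w x)\<^sup>2" for i x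
    unfolding F_def[abs_def]
    by (subst partial_mult) (auto simp: smooth3_component sw smooth3_differentiable partial_component pw power2_eq_square)
  have p\<psi>: "partial i (\<lambda>x. \<psi> x * \<psi> x) = (\<lambda>x. 2 * \<psi> x * partial i \<psi> x)" for i
    using s\<psi> by (auto simp: partial_mult smooth3_differentiable)
  have int: "integrable lborel (\<lambda>x. F i x * (\<psi> x * partial i \<psi> x))"
    "integrable lborel (\<lambda>x. (F i x)\<^sup>2 * (\<psi> x * \<psi> x))"
    "integrable lborel (\<lambda>x. partial i (F i) x * (\<psi> x * \<psi> x))"
    "integrable lborel (\<lambda>x. (partial i \<psi> x)\<^sup>2)" for i
    unfolding power2_eq_square
    by (intro test_fun_integrable test_fun_mult smooth3_mult sF s\<psi> \<psi> smooth3_partial test_fun_partial)+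
  have ibp: "2 * (\<integral>x. F i x * (\<psi> x * partial i \<psi> x) \<partial>lborel) = - (\<integral>x. partial i (F i) x * (\<psi> x * \<psi> x) \<partial>lborel)" for i
    using integral_by_parts_test_fun[OF sF test_fun_mult[OF s\<psi> \<psi>], of i i] unfolding p\<psi>
    by (simp add: mult.left_commute[of 2] mult.assoc flip: integral_mult_right_zero)
  have alg: "(\<Sum>i\<in>UNIV. partial i (F i) x * (\<psi> x * \<psi> x) - (F i x)\<^sup>2 * (\<psi> x * \<psi> x))
      = 3 * (\<psi> x)\<^sup>2 / (1 + (norm x)\<^sup>2)\<^sup>2" for x
  proof -
    have "(\<Sum>i\<in>UNIV. partial i (F i) x * (\<psi> x * \<psi> x) - (F i x)\<^sup>2 * (\<psi> x * \<psi> x))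
      = (\<Sum>i\<in>UNIV. (\<psi> x)\<^sup>2 * w x - 3 * (\<psi> x)\<^sup>2 * (w x)\<^sup>2 * (x $ i)\<^sup>2)"
      by (rule sum.cong) (auto simp: pF F_def power2_eq_square algebra_simps)
    also have "\<dots> = 3 * (\<psi> x)\<^sup>2 * w x - 3 * (\<psi> x)\<^sup>2 * (w x)\<^sup>2 * (norm x)\<^sup>2"
      by (simp add: sum_subtractf norm_power2_R3 sum_distrib_left)
    also have "\<dots> = 3 * (\<psi> x)\<^sup>2 * (w x - (w x)\<^sup>2 * (norm x)\<^sup>2)"
      by (simp add: algebra_simps)
    also have "w x - (w x)\<^sup>2 * (norm x)\<^sup>2 = (w x)\<^sup>2"
    proof -
      have "w x = (w x)\<^sup>2 * (1 + (norm x)\<^sup>2)"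
        using pos[of x] by (simp add: w power2_eq_square)
      then show ?thesis by (simp add: algebra_simps)
    qed
    finally show ?thesis by (simp add: w power_divide)
  qed
  show I: "integrable lborel (\<lambda>x. 3 * (\<psi> x)\<^sup>2 / (1 + (norm x)\<^sup>2)\<^sup>2)"
    unfolding alg[symmetric] by (intro Bochner_Integration.integrable_sum Bochner_Integration.integrable_diff int)
  have "0 \<le> (\<Sum>i\<in>UNIV. \<integral>x. (partial i \<psi> x + F i x * \<psi> x)\<^sup>2 \<partial>lborel)"
    by (intro sum_nonneg integral_nonneg) auto
  also have "\<dots> = (\<Sum>i\<in>UNIV. (\<integral>x. (partial i \<psi> x)\<^sup>2 \<partial>lborel) -
      (\<integral>x. partial i (F i) x * (\<psi> x * \<psi> x) - (F i x)\<^sup>2 * (\<psi> x * \<psi> x) \<partial>lborel))"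
  proof (rule sum.cong[OF refl])
    fix i
    have "(\<integral>x. (partial i \<psi> x + F i x * \<psi> x)\<^sup>2 \<partial>lborel) =
      (\<integral>x. (partial i \<psi> x)\<^sup>2 + 2 * (F i x * (\<psi> x * partial i \<psi> x)) + (F i x)\<^sup>2 * (\<psi> x * \<psi> x) \<partial>lborel)"
      by (rule Bochner_Integration.integral_cong) (auto simp: power2_eq_square algebra_simps)
    also have "\<dots> = (\<integral>x. (partial i \<psi> x)\<^sup>2 \<partial>lborel) -
      (\<integral>x. partial i (F i) x * (\<psi> x * \<psi> x) - (F i x)\<^sup>2 * (\<psi> x * \<psi> x) \<partial>lborel)"
      using int[of i] ibp[of i] by simp
    finally show "(\<integral>x. (partial i \<psi> x + F i x * \<psi> x)\<^sup>2 \<partial>lborel) = \<dots>" .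
  qed
  also have "\<dots> = (\<integral>x. (norm (grad \<psi> x))\<^sup>2 \<partial>lborel) - (\<integral>x. 3 * (\<psi> x)\<^sup>2 / (1 + (norm x)\<^sup>2)\<^sup>2 \<partial>lborel)"
    unfolding alg[symmetric] norm_grad_power2 sum_subtractf[symmetric] using int
    by (subst (1 2) Bochner_Integration.integral_sum) (auto simp: sum_subtractf)
  finally show "(\<integral>x. 3 * (\<psi> x)\<^sup>2 / (1 + (norm x)\<^sup>2)\<^sup>2 \<partial>lborel) \<le> (\<integral>x. (norm (grad \<psi> x))\<^sup>2 \<partial>lborel)"
    by simp
qed

text \<open>The approximating test functions have gradients tending to 0 in L2. The Hardy inequality
  transfers this to their weighted L2 norms, and Fatou's lemma to \<phi>. The weight is positive
  everywhere, so \<phi> vanishes almost everywhere.\<close>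

lemma D12_grad_zero_imp_zero:
  assumes "D12_grad \<phi> G" "AE x in lborel. G x = 0"
  shows "AE x in lborel. \<phi> x = 0"
proof -
  obtain \<psi> where \<psi>: "\<And>n. test_fun (\<psi> n)" "AE x in lborel. (\<lambda>n. \<psi> n x) \<longlonglongrightarrow> \<phi> x"
    "(\<lambda>n. \<integral>x. (norm (grad (\<psi> n) x - G x))\<^sup>2 \<partial>lborel) \<longlonglongrightarrow> 0"
    using assms(1) by (auto simp: D12_grad_def)
  have [measurable]: "\<phi> \<in> borel_measurable borel" "G \<in> borel_measurable borel"
    using assms(1) by (auto simp: D12_grad_def weak_grad_def)
  have m [measurable]: "\<psi> n \<in> borel_measurable borel" "grad (\<psi> n) \<in> borel_measurable borel" for n
    using \<psi>(1)[of n] by (auto intro: smooth3_measurable measurable_grad test_funD)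
  define k :: "R3 \<Rightarrow> real" where "k x = 3 / (1 + (norm x)\<^sup>2)\<^sup>2" for x
  have [measurable]: "k \<in> borel_measurable borel" unfolding k_def[abs_def] by measurable
  have k: "k x > 0" for x 
    unfolding k_def by (intro divide_pos_pos zero_less_power add_pos_nonneg) auto
  have "(\<integral>x. (norm (grad (\<psi> n) x - G x))\<^sup>2 \<partial>lborel) = (\<integral>x. (norm (grad (\<psi> n) x))\<^sup>2 \<partial>lborel)" for n
    using assms(2) by (intro integral_cong_AE) auto
  with \<psi>(3) have lim: "(\<lambda>n. \<integral>x. (norm (grad (\<psi> n) x))\<^sup>2 \<partial>lborel) \<longlonglongrightarrow> 0" by simp
  have le: "(\<integral>\<^sup>+x. ennreal (k x * (\<psi> n x)\<^sup>2) \<partial>lborel) \<le> ennreal (\<integral>x. (norm (grad (\<psi> n) x))\<^sup>2 \<partial>lborel)" for n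
    using hardy_test_fun[OF \<psi>(1)[of n]] k
    by (subst nn_integral_eq_integral) (auto simp: k_def intro!: ennreal_leI)
  have "(\<integral>\<^sup>+x. ennreal (k x * (\<phi> x)\<^sup>2) \<partial>lborel) = (\<integral>\<^sup>+x. liminf (\<lambda>n. ennreal (k x * (\<psi> n x)\<^sup>2)) \<partial>lborel)"
  proof (rule nn_integral_cong_AE)
    show "AE x in lborel. ennreal (k x * (\<phi> x)\<^sup>2) = liminf (\<lambda>n. ennreal (k x * (\<psi> n x)\<^sup>2))"
      using \<psi>(2)
    proof eventually_elim
      case (elim x)
      then have "(\<lambda>n. ennreal (k x * (\<psi> n x)\<^sup>2)) \<longlonglongrightarrow> ennreal (k x * (\<phi> x)\<^sup>2)"
        by (intro tendsto_intros)
      then show ?case by (simp add: lim_imp_Liminf)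
    qed
  qed
  also have "\<dots> \<le> liminf (\<lambda>n. \<integral>\<^sup>+x. ennreal (k x * (\<psi> n x)\<^sup>2) \<partial>lborel)"
    by (rule nn_integral_liminf) measurable
  also have "\<dots> \<le> liminf (\<lambda>n. ennreal (\<integral>x. (norm (grad (\<psi> n) x))\<^sup>2 \<partial>lborel))"
    by (rule Liminf_mono) (simp add: le)
  also have "\<dots> = ennreal 0"
    using lim by (intro lim_imp_Liminf tendsto_ennrealI) auto
  finally have "(\<integral>\<^sup>+x. ennreal (k x * (\<phi> x)\<^sup>2) \<partial>lborel) = 0" by simp
  then have "AE x in lborel. ennreal (k x * (\<phi> x)\<^sup>2) = 0"
    by (subst (asm) nn_integral_0_iff_AE) auto
  then show ?thesis
  proof eventually_elim
    case (elim x)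
    with k[of x] show ?case by (simp add: ennreal_eq_0_iff mult_le_0_iff)
  qed
qed

section \<open>Convolution\<close>

definition conv :: "(R3 \<Rightarrow> real) \<Rightarrow> (R3 \<Rightarrow> real) \<Rightarrow> R3 \<Rightarrow> real" where
  "conv \<eta> v x = (\<integral>y. \<eta> (x - y) * v y \<partial>lborel)"

lemma integrable_bounded_mult:
  fixes v g :: "R3 \<Rightarrow> real"
  assumes "integrable lborel v" "g \<in> borel_measurable borel" "\<And>x. \<bar>g x\<bar> \<le> M"
  shows "integrable lborel (\<lambda>x. g x * v x)"
proof (rule Bochner_Integration.integrable_bound)
  show "integrable lborel (\<lambda>x. M * v x)" using assms(1) by simp
  show "(\<lambda>x. g x * v x) \<in> borel_measurable lborel"
    using assms(1,2) by measurable
  show "AE x in lborel. norm (g x * v x) \<le> norm (M * v x)"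
    using order_trans[OF assms(3) abs_ge_self[of M]] by (auto simp: abs_mult intro!: mult_right_mono)
qed

lemma conv_integrable:
  assumes "test_fun \<eta>" "integrable lborel v"
  shows "integrable lborel (\<lambda>y. \<eta> (x - y) * v y)"
proof -
  have [measurable]: "\<eta> \<in> borel_measurable borel"
    using assms(1) by (auto intro: smooth3_measurable test_funD)
  obtain M where "\<And>x. \<bar>\<eta> x\<bar> \<le> M" using test_fun_bounded[OF assms(1)] by metis
  then show ?thesis using assms(2) by (intro integrable_bounded_mult) auto
qed

lemma conv_grad_integrable:
  assumes \<eta>: "test_fun \<eta>" and v: "integrable lborel v"
  shows "integrable lborel (\<lambda>y. v y *\<^sub>R grad \<eta> (x - y))"
proof -
  obtain M where M: "M \<ge> 0" "\<And>x. norm (grad \<eta> x) \<le> M"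
    using test_fun_grad_bounded[OF \<eta>] by metis
  have [measurable]: "grad \<eta> \<in> borel_measurable borel" "v \<in> borel_measurable borel"
    using \<eta> v by (auto intro: measurable_grad test_funD)
  show ?thesis
  proof (rule Bochner_Integration.integrable_bound)
    show "integrable lborel (\<lambda>x. M * v x)" using v by simp
    show "AE y in lborel. norm (v y *\<^sub>R grad \<eta> (x - y)) \<le> norm (M * v y)"
      using M mult_left_mono[OF M(2) abs_ge_zero] by (auto simp: abs_mult mult.commute[of M])
  qed measurable
qed

text \<open>Differentiation under the integral sign by dominated convergence: the smoothness comes
  from \<eta> alone, while |v| supplies the integrable majorant. Sequences replace the limit at
  \<open>x\<close> because dominated convergence is sequential.\<close>

lemma has_derivative_conv:
  assumes \<eta>: "test_fun \<eta>" and v: "integrable lborel v"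
  shows "(conv \<eta> v has_derivative (\<lambda>h. (\<integral>y. v y *\<^sub>R grad \<eta> (x - y) \<partial>lborel) \<bullet> h)) (at x)"
proof -
  obtain M where M: "M \<ge> 0" "\<And>x. norm (grad \<eta> x) \<le> M"
    using test_fun_grad_bounded[OF \<eta>] by metis
  have [measurable]: "\<eta> \<in> borel_measurable borel" "grad \<eta> \<in> borel_measurable borel"
    using \<eta> by (auto intro: smooth3_measurable measurable_grad test_funD)
  have [measurable]: "v \<in> borel_measurable borel" using v by simp
  have intg: "integrable lborel (\<lambda>y. v y *\<^sub>R grad \<eta> (x - y))"
    by (rule conv_grad_integrable[OF assms])
  let ?L = "\<lambda>h. (\<integral>y. v y *\<^sub>R grad \<eta> (x - y) \<partial>lborel) \<bullet> h"
  show ?thesis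
    unfolding has_derivative_iff_norm
  proof (intro conjI)
    show "bounded_linear ?L" by (rule bounded_linear_inner_right)
    show "((\<lambda>z. norm (conv \<eta> v z - conv \<eta> v x - ?L (z - x)) / norm (z - x)) \<longlongrightarrow> 0) (at x)"
      unfolding tendsto_at_iff_sequentially
    proof (intro allI impI)
      fix X :: "nat \<Rightarrow> R3" assume X: "\<forall>i. X i \<in> UNIV - {x}" "X \<longlonglongrightarrow> x"
      \<comment> \<open>The first-order remainder of \<eta> at \<open>x - y\<close>, divided by the
        size of the increment: at most \<open>2 * M\<close> for all \<open>y\<close>, and tending to
        0 for each \<open>y\<close>.\<close>
      define q where "q n y = (\<eta> (X n - y) - \<eta> (x - y) - grad \<eta> (x - y) \<bullet> (X n - x)) / norm (X n - x)" for n y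
      have [measurable]: "q n \<in> borel_measurable borel" for n
        unfolding q_def[abs_def] by measurable
      have pos: "norm (X n - x) > 0" for n using X(1) by auto
      have q_le: "\<bar>q n y\<bar> \<le> 2 * M" for n y
      proof -
        have "\<bar>\<eta> (X n - y) - \<eta> (x - y)\<bar> \<le> M * norm (X n - x)"
          using test_fun_lipschitz[OF \<eta> M(2), of "X n - y" "x - y"] by simp
        moreover have "\<bar>grad \<eta> (x - y) \<bullet> (X n - x)\<bar> \<le> M * norm (X n - x)"
          using Cauchy_Schwarz_ineq2[of "grad \<eta> (x - y)" "X n - x"]
            mult_right_mono[OF M(2)[of "x - y"] norm_ge_zero[of "X n - x"]] by linarith
        ultimately have "\<bar>\<eta> (X n - y) - \<eta> (x - y) - grad \<eta> (x - y) \<bullet> (X n - x)\<bar> \<le> 2 * M * norm (X n - x)"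
          by linarith
        then show ?thesis using pos[of n] by (simp add: q_def field_simps)
      qed
      have q_lim: "(\<lambda>n. q n y) \<longlonglongrightarrow> 0" for y
      proof -
        have "((\<lambda>z. norm (\<eta> z - \<eta> (x - y) - grad \<eta> (x - y) \<bullet> (z - (x - y))) / norm (z - (x - y))) \<longlongrightarrow> 0) (at (x - y))"
          using has_derivative_grad[OF smooth3_differentiable[OF test_funD(1)[OF \<eta>]], of "x - y"]
          by (simp add: has_derivative_iff_norm)
        moreover have "(\<lambda>n. X n - y) \<longlonglongrightarrow> x - y" using X(2) by (intro tendsto_intros)
        ultimately have "(\<lambda>n. norm (\<eta> (X n - y) - \<eta> (x - y) - grad \<eta> (x - y) \<bullet> (X n - x)) / norm (X n - x)) \<longlonglongrightarrow> 0"
          unfolding tendsto_at_iff_sequentially using X(1) by (auto simp: o_def dest!: spec[of _ "\<lambda>n. X n - y"])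
        then have "(\<lambda>n. \<bar>q n y\<bar>) \<longlonglongrightarrow> 0" by (simp add: q_def)
        then show ?thesis by (simp add: tendsto_rabs_zero_iff)
      qed
      have "(\<lambda>n. \<integral>y. q n y * v y \<partial>lborel) \<longlonglongrightarrow> (\<integral>y. 0 \<partial>(lborel :: R3 measure))"
      proof (rule integral_dominated_convergence[where w = "\<lambda>y. 2 * M * \<bar>v y\<bar>"])
        show "AE y in lborel. (\<lambda>n. q n y * v y) \<longlonglongrightarrow> 0"
          using tendsto_mult_right[OF q_lim] by auto
        show "AE y in lborel. norm (q n y * v y) \<le> 2 * M * \<bar>v y\<bar>" for n
          using q_le by (auto simp: abs_mult intro!: mult_right_mono)
      qed (use v in auto)
      then have lim: "(\<lambda>n. \<bar>\<integral>y. q n y * v y \<partial>lborel\<bar>) \<longlonglongrightarrow> 0"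
        using tendsto_rabs_zero by simp
      have "norm (conv \<eta> v (X n) - conv \<eta> v x - ?L (X n - x)) / norm (X n - x)
          = \<bar>\<integral>y. q n y * v y \<partial>lborel\<bar>" for n
      proof -
        have i3: "integrable lborel (\<lambda>y. (v y *\<^sub>R grad \<eta> (x - y)) \<bullet> (X n - x))"
          using intg by (rule integrable_inner_left)
        have "?L (X n - x) = (\<integral>y. (v y *\<^sub>R grad \<eta> (x - y)) \<bullet> (X n - x) \<partial>lborel)"
          using intg by (subst integral_inner_left) auto
        then have "conv \<eta> v (X n) - conv \<eta> v x - ?L (X n - x)
          = (\<integral>y. \<eta> (X n - y) * v y - \<eta> (x - y) * v y - (v y *\<^sub>R grad \<eta> (x - y)) \<bullet> (X n - x) \<partial>lborel)"
          using conv_integrable[OF \<eta> v] i3 by (simp add: conv_def)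
        also have "\<dots> = (\<integral>y. norm (X n - x) * (q n y * v y) \<partial>lborel)"
        proof (rule Bochner_Integration.integral_cong[OF refl])
          fix y
          have "norm (X n - x) * q n y = \<eta> (X n - y) - \<eta> (x - y) - grad \<eta> (x - y) \<bullet> (X n - x)"
            using pos[of n] by (simp add: q_def)
          then show "\<eta> (X n - y) * v y - \<eta> (x - y) * v y - (v y *\<^sub>R grad \<eta> (x - y)) \<bullet> (X n - x)
              = norm (X n - x) * (q n y * v y)"
            unfolding mult.assoc[symmetric] by (simp add: left_diff_distrib)
        qed
        also have "\<dots> = norm (X n - x) * (\<integral>y. q n y * v y \<partial>lborel)" by simp
        finally show ?thesis using pos[of n] by (simp add: abs_mult)
      qed
      with lim show "((\<lambda>z. norm (conv \<eta> v z - conv \<eta> v x - ?L (z - x)) / norm (z - x)) \<circ> X) \<longlonglongrightarrow> 0"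
        by (simp add: o_def)
    qed
  qed
qed

lemma partial_conv:
  assumes \<eta>: "test_fun \<eta>" and v: "integrable lborel v"
  shows "partial i (conv \<eta> v) = conv (partial i \<eta>) v"
proof
  fix x
  have intg: "integrable lborel (\<lambda>y. v y *\<^sub>R grad \<eta> (x - y))"
    by (rule conv_grad_integrable[OF assms])
  have "partial i (conv \<eta> v) x = (\<integral>y. v y *\<^sub>R grad \<eta> (x - y) \<partial>lborel) \<bullet> axis i 1"
    by (rule partial_eqI[OF has_derivative_conv[OF assms]])
  also have "\<dots> = (\<integral>y. (v y *\<^sub>R grad \<eta> (x - y)) \<bullet> axis i 1 \<partial>lborel)"
    using intg by (subst integral_inner_left) auto
  also have "\<dots> = conv (partial i \<eta>) v x"
    unfolding conv_def by (intro Bochner_Integration.integral_cong) (auto simp: inner_axis grad_def)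
  finally show "partial i (conv \<eta> v) x = conv (partial i \<eta>) v x" .
qed

text \<open>Each partial falls on the test function and leaves a test function, so the convolutions
  with a fixed \<open>v\<close> form a stable class.\<close>

lemma smooth3_conv:
  assumes "test_fun \<eta>" "integrable lborel v"
  shows "smooth3 (conv \<eta> v)"
proof (rule smooth3_coinduct[where P = "\<lambda>g. \<exists>\<eta>. test_fun \<eta> \<and> g = conv \<eta> v"])
  show "g differentiable (at x)" if "\<exists>\<eta>. test_fun \<eta> \<and> g = conv \<eta> v" for g x
    using that has_derivative_conv[OF _ assms(2)] by (force simp: differentiable_def)
qed (use assms in \<open>auto simp: partial_conv intro: test_fun_partial\<close>)

lemma conv_eq_0:
  assumes "\<And>y. \<eta> (x - y) = 0 \<or> v y = 0" shows "conv \<eta> v x = 0"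
proof -
  have "(\<lambda>y. \<eta> (x - y) * v y) = (\<lambda>_. 0)" using assms by auto
  then show ?thesis by (simp add: conv_def)
qed

lemma conv_support:
  assumes "\<And>x. \<eta> x \<noteq> 0 \<Longrightarrow> norm x \<le> r" "\<And>x. v x \<noteq> 0 \<Longrightarrow> norm x \<le> R" "conv \<eta> v x \<noteq> 0"
  shows "norm x \<le> r + R"
proof -
  obtain y where "\<eta> (x - y) \<noteq> 0" "v y \<noteq> 0" using assms(3) conv_eq_0 by blast
  with assms(1,2) have "norm (x - y) \<le> r" "norm y \<le> R" by auto
  then show ?thesis using norm_triangle_ineq[of "x - y" y] by simp
qed

lemma test_fun_conv:
  assumes "test_fun \<eta>" "integrable lborel v" "bounded {x. v x \<noteq> 0}"
  shows "test_fun (conv \<eta> v)"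
proof -
  obtain r R where "\<And>x. \<eta> x \<noteq> 0 \<Longrightarrow> norm x \<le> r" "\<And>x. v x \<noteq> 0 \<Longrightarrow> norm x \<le> R"
    using test_funD(2)[OF assms(1)] assms(3) by (auto simp: bounded_iff)
  then have "\<And>x. conv \<eta> v x \<noteq> 0 \<Longrightarrow> norm x \<le> r + R" by (rule conv_support)
  then have "bounded {x. conv \<eta> v x \<noteq> 0}" by (auto simp: bounded_iff)
  with smooth3_conv[OF assms(1,2)] show ?thesis by (simp add: test_fun_iff)
qed

text \<open>For fixed \<open>x\<close>, the map y -> \<eta> (x - y) is itself a test function and
  may be inserted in the definition of \<open>weak_grad\<close>; the sign from the reflection
  cancels the sign from integration by parts.\<close>

lemma partial_conv_weak_grad:
  assumes \<eta>: "test_fun \<eta>" and v: "integrable lborel v" and w: "weak_grad v G"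
  shows "partial i (conv \<eta> v) x = conv \<eta> (\<lambda>y. G y $ i) x"
proof -
  define \<psi> where "\<psi> = (\<lambda>y. \<eta> (x + (-1) *\<^sub>R y))"
  have t: "test_fun \<psi>" unfolding \<psi>_def by (rule test_fun_affine[OF \<eta>]) simp
  have p: "partial i \<psi> = (\<lambda>y. - partial i \<eta> (x - y))"
    unfolding \<psi>_def
    using partial_affine(1)[OF smooth3_differentiable[OF test_funD(1)[OF \<eta>]], where a = x and c = "-1"] by auto
  have "(\<integral>y. v y * partial i \<psi> y \<partial>lborel) = - (\<integral>y. G y $ i * \<psi> y \<partial>lborel)"
    using w t by (auto simp: weak_grad_def)
  then show ?thesis
    unfolding partial_conv[OF \<eta> v] p unfolding conv_def \<psi>_def by (simp add: mult.commute)
qed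

text \<open>Tonelli's theorem, after which translation invariance reduces the inner integral to the
  unit mass of \<eta>. Both norm estimates for convolutions rest on this identity.\<close>

lemma nn_integral_conv:
  fixes f :: "R3 \<Rightarrow> ennreal"
  assumes [measurable]: "\<eta> \<in> borel_measurable borel" "f \<in> borel_measurable borel"
    and \<eta>: "(\<integral>\<^sup>+x. ennreal (\<eta> x) \<partial>lborel) = 1"
  shows "(\<integral>\<^sup>+x. (\<integral>\<^sup>+y. ennreal (\<eta> (x - y)) * f y \<partial>lborel) \<partial>lborel) = (\<integral>\<^sup>+y. f y \<partial>lborel)"
proof -
  have "(\<integral>\<^sup>+x. (\<integral>\<^sup>+y. ennreal (\<eta> (x - y)) * f y \<partial>lborel) \<partial>lborel)
      = (\<integral>\<^sup>+y. (\<integral>\<^sup>+x. ennreal (\<eta> (x - y)) * f y \<partial>lborel) \<partial>lborel)"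
    by (rule lborel_pair.Fubini') measurable
  also have "\<dots> = (\<integral>\<^sup>+y. f y \<partial>lborel)"
  proof (rule nn_integral_cong)
    fix y
    have "(\<integral>\<^sup>+x. ennreal (\<eta> (x - y)) * f y \<partial>lborel) = (\<integral>\<^sup>+x. ennreal (\<eta> (x - y)) \<partial>lborel) * f y"
      by (rule nn_integral_multc) measurable
    also have "(\<integral>\<^sup>+x. ennreal (\<eta> (x - y)) \<partial>lborel) = 1"
      using nn_integral_affine_unit[of "\<lambda>x. ennreal (\<eta> x)" 1 "- y"] \<eta> by simp
    finally show "(\<integral>\<^sup>+x. ennreal (\<eta> (x - y)) * f y \<partial>lborel) = f y" by simp
  qed
  finally show ?thesis .
qed

section \<open>Mollifiers do not increase L1 and L2 norms\<close>

definition mollifier :: "(R3 \<Rightarrow> real) \<Rightarrow> bool" where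
  "mollifier \<eta> \<longleftrightarrow> test_fun \<eta> \<and> (\<forall>x. 0 \<le> \<eta> x) \<and> (\<integral>x. \<eta> x \<partial>lborel) = 1"

lemma mollifierD:
  assumes "mollifier \<eta>"
  shows "test_fun \<eta>" "0 \<le> \<eta> x" "(\<integral>x. \<eta> x \<partial>lborel) = 1" "\<eta> \<in> borel_measurable borel"
    "(\<integral>\<^sup>+x. ennreal (\<eta> x) \<partial>lborel) = 1"
    "integrable lborel (\<lambda>y. \<eta> (x - y))" "(\<integral>y. \<eta> (x - y) \<partial>lborel) = 1"
proof -
  show t: "test_fun \<eta>" and "0 \<le> \<eta> x" and 1: "(\<integral>x. \<eta> x \<partial>lborel) = 1"
    using assms by (auto simp: mollifier_def)
  show m: "\<eta> \<in> borel_measurable borel" using t by (auto intro: smooth3_measurable test_funD)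
  show "(\<integral>\<^sup>+x. ennreal (\<eta> x) \<partial>lborel) = 1"
    using assms by (subst nn_integral_eq_integral) (auto simp: mollifier_def test_fun_integrable)
  show "integrable lborel (\<lambda>y. \<eta> (x - y))" "(\<integral>y. \<eta> (x - y) \<partial>lborel) = 1"
    using integrable_affine_unit[OF m, of "-1" x] integral_affine_unit[OF m, of "-1" x] test_fun_integrable[OF t] 1
    by simp_all
qed

lemma nn_integral_conv_abs_le:
  assumes \<eta>: "mollifier \<eta>" and v: "integrable lborel v"
  shows "(\<integral>\<^sup>+x. ennreal \<bar>conv \<eta> v x\<bar> \<partial>lborel) \<le> (\<integral>\<^sup>+x. ennreal \<bar>v x\<bar> \<partial>lborel)"
proof -
  note [measurable] = mollifierD(4)[OF \<eta>]
  have [measurable]: "v \<in> borel_measurable borel" using v by simp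
  have "ennreal \<bar>conv \<eta> v x\<bar> \<le> (\<integral>\<^sup>+y. ennreal (\<eta> (x - y)) * ennreal \<bar>v y\<bar> \<partial>lborel)" for x
  proof -
    have "ennreal \<bar>conv \<eta> v x\<bar> \<le> (\<integral>\<^sup>+y. ennreal (norm (\<eta> (x - y) * v y)) \<partial>lborel)"
      using integral_norm_bound_ennreal[OF conv_integrable[OF mollifierD(1)[OF \<eta>] v], of x] by (simp add: conv_def)
    also have "\<dots> = (\<integral>\<^sup>+y. ennreal (\<eta> (x - y)) * ennreal \<bar>v y\<bar> \<partial>lborel)"
      by (intro nn_integral_cong) (simp add: abs_mult mollifierD(2)[OF \<eta>] ennreal_mult)
    finally show ?thesis .
  qed
  then have "(\<integral>\<^sup>+x. ennreal \<bar>conv \<eta> v x\<bar> \<partial>lborel)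
      \<le> (\<integral>\<^sup>+x. (\<integral>\<^sup>+y. ennreal (\<eta> (x - y)) * ennreal \<bar>v y\<bar> \<partial>lborel) \<partial>lborel)"
    by (rule nn_integral_mono)
  also have "\<dots> = (\<integral>\<^sup>+x. ennreal \<bar>v x\<bar> \<partial>lborel)"
    by (rule nn_integral_conv) (auto simp: mollifierD(5)[OF \<eta>])
  finally show ?thesis .
qed

text \<open>Jensen's inequality, in the form that a variance is nonnegative.\<close>
lemma conv_power2_le:
  assumes \<eta>: "mollifier \<eta>" and [measurable]: "g \<in> borel_measurable borel"
    and g: "integrable lborel (\<lambda>x. (g x)\<^sup>2)"
  shows "(conv \<eta> g x)\<^sup>2 \<le> conv \<eta> (\<lambda>y. (g y)\<^sup>2) x"
proof -
  note [measurable] = mollifierD(4)[OF \<eta>]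
  have i2: "integrable lborel (\<lambda>y. \<eta> (x - y) * (g y)\<^sup>2)"
    by (rule conv_integrable[OF mollifierD(1)[OF \<eta>] g])
  \<comment> \<open>Only the square of \<open>g\<close> is assumed integrable; |g| is at most its
    square plus 1, and the 1 is paid for by the integrability of \<eta>.\<close>
  have i1: "integrable lborel (\<lambda>y. \<eta> (x - y) * g y)"
  proof (rule Bochner_Integration.integrable_bound)
    show "integrable lborel (\<lambda>y. \<eta> (x - y) * (g y)\<^sup>2 + \<eta> (x - y))"
      using i2 mollifierD(6)[OF \<eta>] by simp
    show "AE y in lborel. norm (\<eta> (x - y) * g y) \<le> norm (\<eta> (x - y) * (g y)\<^sup>2 + \<eta> (x - y))"
    proof (rule AE_I2)
      fix y
      have "2 * \<bar>g y\<bar> \<le> (g y)\<^sup>2 + 1"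
        using zero_le_power2[of "\<bar>g y\<bar> - 1"] by (simp add: power2_diff)
      then have "\<bar>g y\<bar> \<le> (g y)\<^sup>2 + 1" using zero_le_power2[of "g y"] by linarith
      then show "norm (\<eta> (x - y) * g y) \<le> norm (\<eta> (x - y) * (g y)\<^sup>2 + \<eta> (x - y))"
        using mult_left_mono[of "\<bar>g y\<bar>" "(g y)\<^sup>2 + 1" "\<eta> (x - y)"] mollifierD(2)[OF \<eta>, of "x - y"]
        by (simp add: abs_mult algebra_simps)
    qed
  qed measurable
  let ?m = "conv \<eta> g x"
  have "0 \<le> (\<integral>y. \<eta> (x - y) * (g y - ?m)\<^sup>2 \<partial>lborel)"
    using mollifierD(2)[OF \<eta>] by (intro Bochner_Integration.integral_nonneg) auto
  also have "\<dots> = (\<integral>y. \<eta> (x - y) * (g y)\<^sup>2 - 2 * ?m * (\<eta> (x - y) * g y) + ?m\<^sup>2 * \<eta> (x - y) \<partial>lborel)"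
    by (intro Bochner_Integration.integral_cong) (auto simp: power2_eq_square algebra_simps)
  also have "\<dots> = conv \<eta> (\<lambda>y. (g y)\<^sup>2) x - 2 * ?m * ?m + ?m\<^sup>2"
    using i1 i2 mollifierD(6,7)[OF \<eta>, of x] by (simp add: conv_def)
  finally show ?thesis by (simp add: power2_eq_square)
qed

lemma nn_integral_conv_power2_le:
  assumes \<eta>: "mollifier \<eta>" and [measurable]: "g \<in> borel_measurable borel"
    and g: "integrable lborel (\<lambda>x. (g x)\<^sup>2)"
  shows "(\<integral>\<^sup>+x. ennreal ((conv \<eta> g x)\<^sup>2) \<partial>lborel) \<le> (\<integral>\<^sup>+x. ennreal ((g x)\<^sup>2) \<partial>lborel)"
proof -
  note [measurable] = mollifierD(4)[OF \<eta>]
  have "ennreal ((conv \<eta> g x)\<^sup>2) \<le> (\<integral>\<^sup>+y. ennreal (\<eta> (x - y)) * ennreal ((g y)\<^sup>2) \<partial>lborel)" for x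
  proof -
    have "ennreal ((conv \<eta> g x)\<^sup>2) \<le> ennreal (conv \<eta> (\<lambda>y. (g y)\<^sup>2) x)"
      by (rule ennreal_leI) (rule conv_power2_le[OF assms])
    also have "\<dots> = (\<integral>\<^sup>+y. ennreal (\<eta> (x - y) * (g y)\<^sup>2) \<partial>lborel)"
      unfolding conv_def using conv_integrable[OF mollifierD(1)[OF \<eta>] g] mollifierD(2)[OF \<eta>]
      by (intro nn_integral_eq_integral[symmetric]) auto
    finally show ?thesis by (simp add: ennreal_mult mollifierD(2)[OF \<eta>])
  qed
  then have "(\<integral>\<^sup>+x. ennreal ((conv \<eta> g x)\<^sup>2) \<partial>lborel)
      \<le> (\<integral>\<^sup>+x. (\<integral>\<^sup>+y. ennreal (\<eta> (x - y)) * ennreal ((g y)\<^sup>2) \<partial>lborel) \<partial>lborel)"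
    by (rule nn_integral_mono)
  also have "\<dots> = (\<integral>\<^sup>+x. ennreal ((g x)\<^sup>2) \<partial>lborel)"
    by (rule nn_integral_conv) (auto simp: mollifierD(5)[OF \<eta>])
  finally show ?thesis .
qed

section \<open>Mollification in L1\<close>

lemma mollifier_exists:
  assumes r: "r > 0"
  obtains \<eta> where "mollifier \<eta>" "\<And>x. norm x \<ge> r \<Longrightarrow> \<eta> x = 0"
proof -
  define b where "b = (\<lambda>x. bump (0 + (1 / r) *\<^sub>R x))"
  have t: "test_fun b" unfolding b_def using r by (intro test_fun_affine test_fun_bump) auto
  have nn: "b x \<ge> 0" for x by (simp add: b_def bump_nonneg)
  have m [measurable]: "b \<in> borel_measurable borel" using t by (auto intro: smooth3_measurable test_funD)
  \<comment> \<open>A nonnegative integrable function with integral 0 vanishes almost everywhere,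
    but the set where \<open>b\<close> is nonzero is open and contains 0, so it is not
    negligible.\<close>
  have "(\<integral>x. b x \<partial>lborel) \<noteq> 0"
  proof
    assume "(\<integral>x. b x \<partial>lborel) = 0"
    then have "AE x in lborel. b x = 0"
      using integral_nonneg_eq_0_iff_AE[OF test_fun_integrable[OF t]] nn by auto
    then have "{x. b x \<noteq> 0} \<in> null_sets lborel"
      by (subst (asm) AE_iff_null) auto
    then have "negligible {x. b x \<noteq> 0}"
      by (simp add: negligible_iff_null_sets null_sets_completionI)
    moreover have "open {x. b x \<noteq> 0}"
      using smooth3_continuous[OF test_funD(1)[OF t], of UNIV] by (intro open_Collect_neq) auto
    moreover have "0 \<in> {x. b x \<noteq> 0}" using bump_0 by (simp add: b_def)
    ultimately show False using open_not_negligible by blast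
  qed
  moreover have "(\<integral>x. b x \<partial>lborel) \<ge> 0" using nn by simp
  ultimately have I: "(\<integral>x. b x \<partial>lborel) > 0" by simp
  let ?\<eta> = "\<lambda>x. (1 / (\<integral>x. b x \<partial>lborel)) * b x"
  show ?thesis
  proof (rule that[of ?\<eta>])
    show "mollifier ?\<eta>"
      unfolding mollifier_def using I nn by (intro conjI test_fun_mult smooth3_const t) auto
    show "?\<eta> x = 0" if "norm x \<ge> r" for x
      using that r by (simp add: b_def bump_eq_0)
  qed
qed

lemma nn_integral_abs_triangle:
  fixes f g h :: "R3 \<Rightarrow> real"
  assumes [measurable]: "f \<in> borel_measurable borel" "g \<in> borel_measurable borel" "h \<in> borel_measurable borel"
  shows "(\<integral>\<^sup>+x. ennreal \<bar>f x - h x\<bar> \<partial>lborel)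
    \<le> (\<integral>\<^sup>+x. ennreal \<bar>f x - g x\<bar> \<partial>lborel) + (\<integral>\<^sup>+x. ennreal \<bar>g x - h x\<bar> \<partial>lborel)"
proof -
  have "(\<integral>\<^sup>+x. ennreal \<bar>f x - h x\<bar> \<partial>lborel)
      \<le> (\<integral>\<^sup>+x. ennreal \<bar>f x - g x\<bar> + ennreal \<bar>g x - h x\<bar> \<partial>lborel)"
    by (intro nn_integral_mono) (simp flip: ennreal_plus)
  also have "\<dots> = (\<integral>\<^sup>+x. ennreal \<bar>f x - g x\<bar> \<partial>lborel) + (\<integral>\<^sup>+x. ennreal \<bar>g x - h x\<bar> \<partial>lborel)"
    by (rule nn_integral_add) auto
  finally show ?thesis .
qed

text \<open>Dominated convergence in the form that the density argument uses twice: a single good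
  index is enough.\<close>

lemma dominated_nn_integral_less:
  fixes s :: "nat \<Rightarrow> R3 \<Rightarrow> real"
  assumes "\<And>n. s n \<in> borel_measurable borel" "integrable lborel w"
    and "AE x in lborel. (\<lambda>n. s n x) \<longlonglongrightarrow> 0" "\<And>n x. \<bar>s n x\<bar> \<le> w x" and \<epsilon>: "\<epsilon> > 0"
  shows "\<exists>n. (\<integral>\<^sup>+x. ennreal \<bar>s n x\<bar> \<partial>lborel) < ennreal \<epsilon>"
proof -
  have i: "integrable lborel (\<lambda>x. \<bar>s n x\<bar>)" for n
    by (rule Bochner_Integration.integrable_bound[OF assms(2)])
       (use assms(1,4) order_trans[OF assms(4) abs_ge_self] in auto)
  have "(\<lambda>n. \<integral>x. \<bar>s n x\<bar> \<partial>lborel) \<longlonglongrightarrow> (\<integral>x. 0 \<partial>(lborel :: R3 measure))"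
    by (rule integral_dominated_convergence[where w = w])
       (use assms in \<open>auto intro!: tendsto_rabs_zero elim!: eventually_mono\<close>)
  then have "\<forall>\<^sub>F n in sequentially. (\<integral>x. \<bar>s n x\<bar> \<partial>lborel) < \<epsilon>"
    using \<epsilon> by (intro order_tendstoD) auto
  then obtain n where n: "(\<integral>x. \<bar>s n x\<bar> \<partial>lborel) < \<epsilon>"
    by (auto simp: eventually_sequentially)
  have "(\<integral>\<^sup>+x. ennreal \<bar>s n x\<bar> \<partial>lborel) = ennreal (\<integral>x. \<bar>s n x\<bar> \<partial>lborel)"
    using i by (intro nn_integral_eq_integral) auto
  with n \<epsilon> show ?thesis by (auto intro!: exI[of _ n] ennreal_lessI)
qed

text \<open>\<open>v\<close> is first truncated in space and in height. The truncation is then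
  approximated by continuous functions that converge to \<open>v\<close> off a negligible set,
  truncated in the same way so that they share an integrable majorant.\<close>

lemma L1_dense_continuous:
  fixes v :: "R3 \<Rightarrow> real"
  assumes v: "integrable lborel v" and \<epsilon>: "\<epsilon> > 0"
  obtains k where "continuous_on UNIV k" "bounded {x. k x \<noteq> 0}"
    "(\<integral>\<^sup>+x. ennreal \<bar>v x - k x\<bar> \<partial>lborel) < ennreal \<epsilon>"
proof -
  have [measurable]: "v \<in> borel_measurable borel" using v by simp
  \<comment> \<open>Passing to the completed measure gives access to \<open>measurable_on\<close>,
    whose definition provides the continuous approximations.\<close>
  have "v \<in> borel_measurable lebesgue"
    by (intro measurable_completion) simp
  then have "v measurable_on UNIV"
    using measurable_on_iff_borel_measurable[of UNIV v] by simp
  then obtain N g where N: "negligible N" and g: "\<And>n. continuous_on UNIV (g n)"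
    and lim: "\<And>x. x \<notin> N \<Longrightarrow> (\<lambda>n. g n x) \<longlonglongrightarrow> v x"
    unfolding measurable_on_def by auto
  have "AE x in lebesgue. x \<notin> N"
    using N by (simp add: negligible_iff_null_sets AE_not_in)
  then have AEN: "AE x in lborel. x \<notin> N" by (simp add: AE_completion_iff)
  have [measurable]: "g n \<in> borel_measurable borel" for n
    using g by (rule borel_measurable_continuous_onI)
  \<comment> \<open>\<open>c m\<close> is a continuous cut-off in space, \<open>h m\<close> clamps
    values to the interval from \<open>- m\<close> to \<open>m\<close>.\<close>
  define c where "c m x = max 0 (min 1 (m - norm x))" for m :: real and x :: R3
  define h where "h m y = max (- m) (min m y)" for m y :: real
  have c: "0 \<le> c m x" "c m x \<le> 1" for m x by (auto simp: c_def)
  have cc: "continuous_on UNIV (c m)" for m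
    unfolding c_def[abs_def] by (intro continuous_intros)
  have cb: "bounded {x. c m x \<noteq> 0}" for m
    by (rule bounded_subset[OF bounded_cball[of 0 m]]) (auto simp: c_def max_def min_def split: if_splits)
  have hc: "continuous_on UNIV (h m)" for m
    unfolding h_def[abs_def] by (intro continuous_intros)
  have [measurable]: "c m \<in> borel_measurable borel" "h m \<in> borel_measurable borel" for m
    using cc hc by (auto intro: borel_measurable_continuous_onI)
  have h: "\<bar>h m y\<bar> \<le> \<bar>y\<bar>" "\<bar>h m y\<bar> \<le> m" if "m \<ge> 0" for m y
    using that by (auto simp: h_def)
  have "\<exists>m::nat. (\<integral>\<^sup>+x. ennreal \<bar>v x - c m x * h m (v x)\<bar> \<partial>lborel) < ennreal (\<epsilon> / 2)"
  proof (rule dominated_nn_integral_less[where s = "\<lambda>m x. v x - c (real m) x * h (real m) (v x)" and w = "\<lambda>x. 2 * \<bar>v x\<bar>" and \<epsilon> = "\<epsilon> / 2"])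
    show "\<bar>v x - c (real n) x * h (real n) (v x)\<bar> \<le> 2 * \<bar>v x\<bar>" for n x
    proof -
      have "\<bar>c (real n) x * h (real n) (v x)\<bar> \<le> 1 * \<bar>v x\<bar>"
        unfolding abs_mult using c[of "real n" x] h[of "real n" "v x"] by (intro mult_mono) auto
      then show ?thesis by linarith
    qed
    show "AE x in lborel. (\<lambda>m. v x - c (real m) x * h (real m) (v x)) \<longlonglongrightarrow> 0"
    proof (rule AE_I2, rule tendsto_eventually)
      fix x
      obtain n :: nat where n: "real n \<ge> norm x + 1 + \<bar>v x\<bar>" using real_arch_simple by blast
      \<comment> \<open>Once \<open>m\<close> exceeds both |x| + 1 and |v x|, neither truncation
        acts at \<open>x\<close>.\<close>
      show "\<forall>\<^sub>F m in sequentially. v x - c (real m) x * h (real m) (v x) = 0"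
        using eventually_ge_at_top[of n]
      proof eventually_elim
        case (elim m)
        then have "real m \<ge> norm x + 1 + \<bar>v x\<bar>" using n by linarith
        then have "norm x + 1 \<le> real m" "v x \<le> real m" "- real m \<le> v x"
          using norm_ge_zero[of x] by linarith+
        then have "c (real m) x = 1" "h (real m) (v x) = v x"
          by (simp_all add: c_def h_def)
        then show ?case by simp
      qed
    qed
    show "(\<lambda>x. v x - c (real n) x * h (real n) (v x)) \<in> borel_measurable borel" for n by measurable
    show "integrable lborel (\<lambda>x. 2 * \<bar>v x\<bar>)" using v by simp
  qed (use \<epsilon> in simp)
  then obtain m :: nat where m: "(\<integral>\<^sup>+x. ennreal \<bar>v x - c m x * h m (v x)\<bar> \<partial>lborel) < ennreal (\<epsilon> / 2)" ..
  let ?w = "\<lambda>x. c m x * h m (v x)"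
  let ?k = "\<lambda>n x. c m x * h m (g n x)"
  have "\<exists>n. (\<integral>\<^sup>+x. ennreal \<bar>?w x - ?k n x\<bar> \<partial>lborel) < ennreal (\<epsilon> / 2)"
  \<comment> \<open>The functions \<open>g n\<close> carry no bound of their own; clamping them at
    \<open>m\<close> bounds each difference by \<open>2 * m\<close> on the support of
    \<open>c m\<close>.\<close>
  proof (rule dominated_nn_integral_less[where s = "\<lambda>n x. ?w x - ?k n x" and w = "\<lambda>x. (2 * real m) * c m x" and \<epsilon> = "\<epsilon> / 2"])
    show "integrable lborel (\<lambda>x. (2 * real m) * c m x)"
      using cc cb by (intro integrable_mult_right integrable_bounded_support)
    show "\<bar>?w x - ?k n x\<bar> \<le> (2 * real m) * c m x" for n x
    proof -
      have "\<bar>h m (v x) - h m (g n x)\<bar> \<le> 2 * real m"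
        using h(2)[of "real m" "v x"] h(2)[of "real m" "g n x"] by linarith
      then have "c m x * \<bar>h m (v x) - h m (g n x)\<bar> \<le> c m x * (2 * real m)"
        using c(1) by (rule mult_left_mono)
      moreover have "\<bar>?w x - ?k n x\<bar> = c m x * \<bar>h m (v x) - h m (g n x)\<bar>"
        unfolding right_diff_distrib[symmetric] abs_mult using c[of "real m" x] by simp
      ultimately show ?thesis by (simp add: mult.commute)
    qed
    show "AE x in lborel. (\<lambda>n. ?w x - ?k n x) \<longlonglongrightarrow> 0"
      using AEN
    proof eventually_elim
      case (elim x)
      have "(\<lambda>n. h m (g n x)) \<longlonglongrightarrow> h m (v x)"
        using hc[of "real m"] by (intro isCont_tendsto_compose[OF _ lim[OF elim]]) (simp add: continuous_on_eq_continuous_at)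
      then have "(\<lambda>n. ?w x - ?k n x) \<longlonglongrightarrow> ?w x - ?w x" by (intro tendsto_intros)
      then show ?case by simp
    qed
    show "(\<lambda>x. ?w x - ?k n x) \<in> borel_measurable borel" for n by measurable
  qed (use \<epsilon> in simp)
  then obtain n where n: "(\<integral>\<^sup>+x. ennreal \<bar>?w x - ?k n x\<bar> \<partial>lborel) < ennreal (\<epsilon> / 2)" ..
  show ?thesis
  proof (rule that[of "?k n"])
    show "continuous_on UNIV (?k n)"
      by (intro continuous_on_mult cc continuous_on_compose2[OF hc g]) auto
    show "bounded {x. ?k n x \<noteq> 0}" by (rule bounded_subset[OF cb[of m]]) auto
    have "(\<integral>\<^sup>+x. ennreal \<bar>v x - ?k n x\<bar> \<partial>lborel)
      \<le> (\<integral>\<^sup>+x. ennreal \<bar>v x - ?w x\<bar> \<partial>lborel) + (\<integral>\<^sup>+x. ennreal \<bar>?w x - ?k n x\<bar> \<partial>lborel)"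
      by (rule nn_integral_abs_triangle) measurable
    also have "\<dots> < ennreal (\<epsilon> / 2) + ennreal (\<epsilon> / 2)"
      using m n by (rule add_strict_mono)
    also have "\<dots> = ennreal \<epsilon>" using \<epsilon> by (simp flip: ennreal_plus)
    finally show "(\<integral>\<^sup>+x. ennreal \<bar>v x - ?k n x\<bar> \<partial>lborel) < ennreal \<epsilon>" .
  qed
qed

text \<open>Uniform continuity makes the difference uniformly small, and a support radius of at most
  1 for \<eta> confines it to a fixed ball, so a uniform bound times the volume controls the L1
  distance.\<close>

lemma conv_continuous_close:
  assumes k: "continuous_on UNIV k" "bounded {x. k x \<noteq> 0}" and \<epsilon>: "\<epsilon> > 0"
  obtains d where "d > 0" "\<And>\<eta>. mollifier \<eta> \<Longrightarrow> (\<And>x. norm x \<ge> d \<Longrightarrow> \<eta> x = 0) \<Longrightarrow>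
    (\<integral>\<^sup>+x. ennreal \<bar>conv \<eta> k x - k x\<bar> \<partial>lborel) \<le> ennreal \<epsilon>"
proof -
  obtain R where R: "\<And>x. k x \<noteq> 0 \<Longrightarrow> norm x \<le> R"
    using k(2) by (auto simp: bounded_iff)
  let ?B = "cball (0::R3) (R + 1)"
  \<comment> \<open>Adding 1 keeps the denominator positive even if the ball has measure 0.\<close>
  define \<epsilon>' where "\<epsilon>' = \<epsilon> / (measure lborel ?B + 1)"
  have vol: "measure lborel ?B \<ge> 0" by simp
  have \<epsilon>': "\<epsilon>' > 0" using \<epsilon> vol by (simp add: \<epsilon>'_def add_nonneg_pos)
  \<comment> \<open>Radius \<open>R + 2\<close>, because \<open>y\<close> lies within distance 1 of
    a point of the ball of radius \<open>R + 1\<close>.\<close>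
  have "uniformly_continuous_on (cball 0 (R + 2)) k"
    using k(1) by (intro compact_uniformly_continuous) (auto intro: continuous_on_subset)
  then obtain d where d: "d > 0" "\<And>x y. x \<in> cball 0 (R + 2) \<Longrightarrow> y \<in> cball 0 (R + 2) \<Longrightarrow> dist y x < d \<Longrightarrow> dist (k y) (k x) < \<epsilon>'"
    using \<epsilon>' unfolding uniformly_continuous_on_def by metis
  show ?thesis
  proof (rule that[of "min 1 d"])
    fix \<eta> assume \<eta>: "mollifier \<eta>" "\<And>x. norm x \<ge> min 1 d \<Longrightarrow> \<eta> x = 0"
    have ik: "integrable lborel k" using k by (rule integrable_bounded_support)
    have [measurable]: "k \<in> borel_measurable borel" using k(1) by (rule borel_measurable_continuous_onI)
    have le: "\<bar>conv \<eta> k x - k x\<bar> \<le> \<epsilon>' * indicator ?B x" for x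
    proof (cases "x \<in> ?B")
      case True
      have i1: "integrable lborel (\<lambda>y. \<eta> (x - y) * k y)" by (rule conv_integrable[OF mollifierD(1)[OF \<eta>(1)] ik])
      have i2: "integrable lborel (\<lambda>y. \<eta> (x - y) * k x)" using mollifierD(6)[OF \<eta>(1)] by simp
      have "conv \<eta> k x - k x = (\<integral>y. \<eta> (x - y) * k y - \<eta> (x - y) * k x \<partial>lborel)"
        using i1 i2 mollifierD(7)[OF \<eta>(1), of x] by (simp add: conv_def)
      also have "\<bar>\<dots>\<bar> \<le> (\<integral>y. \<epsilon>' * \<eta> (x - y) \<partial>lborel)"
      proof (rule integral_abs_bound_integral)
        show "integrable lborel (\<lambda>y. \<eta> (x - y) * k y - \<eta> (x - y) * k x)" using i1 i2 by simp
        show "integrable lborel (\<lambda>y. \<epsilon>' * \<eta> (x - y))" using mollifierD(6)[OF \<eta>(1)] by simp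
        fix y
        show "\<bar>\<eta> (x - y) * k y - \<eta> (x - y) * k x\<bar> \<le> \<epsilon>' * \<eta> (x - y)"
        proof (cases "norm (x - y) \<ge> min 1 d")
          case False
          then have "norm (x - y) < 1" "norm (x - y) < d" by auto
          moreover have "norm y \<le> norm x + norm (x - y)"
            using norm_triangle_ineq4[of x "x - y"] by simp
          ultimately have "dist (k y) (k x) < \<epsilon>'"
            using True by (intro d(2)) (auto simp: dist_norm norm_minus_commute)
          then have "\<eta> (x - y) * \<bar>k y - k x\<bar> \<le> \<eta> (x - y) * \<epsilon>'"
            using mollifierD(2)[OF \<eta>(1)] by (intro mult_left_mono) (auto simp: dist_real_def)
          moreover have "\<bar>\<eta> (x - y) * k y - \<eta> (x - y) * k x\<bar> = \<eta> (x - y) * \<bar>k y - k x\<bar>"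
            unfolding right_diff_distrib[symmetric] abs_mult using mollifierD(2)[OF \<eta>(1), of "x - y"] by simp
          ultimately show ?thesis by (simp add: mult.commute)
        qed (simp add: \<eta>(2))
      qed
      also have "\<dots> = \<epsilon>'" using mollifierD(7)[OF \<eta>(1), of x] by simp
      finally show ?thesis using True by simp
    next
      case False
      then have n: "norm x > R + 1" by simp
      have "conv \<eta> k x = 0"
      proof (rule ccontr)
        assume "conv \<eta> k x \<noteq> 0"
        moreover have "norm x \<le> 1" if "\<eta> x \<noteq> 0" for x using \<eta>(2)[of x] that by linarith
        ultimately have "norm x \<le> 1 + R" using R conv_support by blast
        with n show False by simp
      qed
      moreover have "k x = 0" using R[of x] n by fastforce
      ultimately show ?thesis using False by simp
    qed
    have "(\<integral>\<^sup>+x. ennreal \<bar>conv \<eta> k x - k x\<bar> \<partial>lborel) \<le> (\<integral>\<^sup>+x. ennreal \<epsilon>' * indicator ?B x \<partial>lborel)"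
    proof (rule nn_integral_mono)
      fix x show "ennreal \<bar>conv \<eta> k x - k x\<bar> \<le> ennreal \<epsilon>' * indicator ?B x"
        using ennreal_leI[OF le[of x]] by (simp split: split_indicator_asm split_indicator)
    qed
    also have "\<dots> = ennreal \<epsilon>' * emeasure lborel ?B" by (simp add: nn_integral_cmult_indicator)
    also have "\<dots> = ennreal (\<epsilon>' * measure lborel ?B)"
      using emeasure_bounded_finite[OF bounded_cball, of "0::R3" "R + 1"] \<epsilon>'
      by (subst emeasure_eq_ennreal_measure) (simp_all add: ennreal_mult less_top)
    also have "\<dots> \<le> ennreal \<epsilon>"
    proof (rule ennreal_leI)
      have "\<epsilon> * measure lborel ?B \<le> \<epsilon> * (measure lborel ?B + 1)"
        using \<epsilon> by (intro mult_left_mono) auto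
      then show "\<epsilon>' * measure lborel ?B \<le> \<epsilon>"
        using vol unfolding \<epsilon>'_def times_divide_eq_left
        by (subst pos_divide_le_eq) (simp_all add: add_nonneg_pos)
    qed
    finally show "(\<integral>\<^sup>+x. ennreal \<bar>conv \<eta> k x - k x\<bar> \<partial>lborel) \<le> ennreal \<epsilon>" .
  qed (use d in auto)
qed

lemma conv_diff:
  assumes "test_fun \<eta>" "integrable lborel v" "integrable lborel w"
  shows "conv \<eta> (\<lambda>x. v x - w x) x = conv \<eta> v x - conv \<eta> w x"
  using conv_integrable[OF assms(1,2), of x] conv_integrable[OF assms(1,3), of x]
  by (simp add: conv_def right_diff_distrib)

text \<open>Three-epsilon argument through a continuous \<open>k\<close>: the distance between the
  two convolutions is at most that of \<open>v\<close> and \<open>k\<close>, whatever the mollifier,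
  so \<open>d\<close> depends only on \<open>k\<close>.\<close>

lemma conv_L1_close:
  assumes v: "integrable lborel v" and \<epsilon>: "\<epsilon> > 0"
  obtains d where "d > 0" "\<And>\<eta>. mollifier \<eta> \<Longrightarrow> (\<And>x. norm x \<ge> d \<Longrightarrow> \<eta> x = 0) \<Longrightarrow>
    (\<integral>\<^sup>+x. ennreal \<bar>conv \<eta> v x - v x\<bar> \<partial>lborel) < ennreal \<epsilon>"
proof -
  obtain k where k: "continuous_on UNIV k" "bounded {x. k x \<noteq> 0}"
    "(\<integral>\<^sup>+x. ennreal \<bar>v x - k x\<bar> \<partial>lborel) < ennreal (\<epsilon> / 3)"
    using L1_dense_continuous[OF v, of "\<epsilon> / 3"] \<epsilon> by auto
  obtain d where d: "d > 0" "\<And>\<eta>. mollifier \<eta> \<Longrightarrow> (\<And>x. norm x \<ge> d \<Longrightarrow> \<eta> x = 0) \<Longrightarrow>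
    (\<integral>\<^sup>+x. ennreal \<bar>conv \<eta> k x - k x\<bar> \<partial>lborel) \<le> ennreal (\<epsilon> / 3)"
    using conv_continuous_close[OF k(1,2), of "\<epsilon> / 3"] \<epsilon> by auto
  have ik: "integrable lborel k" using k(1,2) by (rule integrable_bounded_support)
  show ?thesis
  proof (rule that[of d])
    fix \<eta> assume \<eta>: "mollifier \<eta>" "\<And>x. norm x \<ge> d \<Longrightarrow> \<eta> x = 0"
    note t = mollifierD(1)[OF \<eta>(1)]
    have [measurable]: "v \<in> borel_measurable borel" "k \<in> borel_measurable borel" using v ik by auto
    have [measurable]: "conv \<eta> v \<in> borel_measurable borel" "conv \<eta> k \<in> borel_measurable borel"
      using smooth3_conv[OF t v] smooth3_conv[OF t ik] by (auto intro: smooth3_measurable)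
    have "(\<integral>\<^sup>+x. ennreal \<bar>conv \<eta> v x - v x\<bar> \<partial>lborel)
      \<le> (\<integral>\<^sup>+x. ennreal \<bar>conv \<eta> v x - conv \<eta> k x\<bar> \<partial>lborel) + (\<integral>\<^sup>+x. ennreal \<bar>conv \<eta> k x - v x\<bar> \<partial>lborel)"
      by (rule nn_integral_abs_triangle) measurable
    also have "\<dots> \<le> (\<integral>\<^sup>+x. ennreal \<bar>conv \<eta> v x - conv \<eta> k x\<bar> \<partial>lborel) +
      ((\<integral>\<^sup>+x. ennreal \<bar>conv \<eta> k x - k x\<bar> \<partial>lborel) + (\<integral>\<^sup>+x. ennreal \<bar>k x - v x\<bar> \<partial>lborel))"
      by (intro add_left_mono nn_integral_abs_triangle) measurable
    also have "\<dots> < ennreal (\<epsilon> / 3) + (ennreal (\<epsilon> / 3) + ennreal (\<epsilon> / 3))"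
    proof (rule add_strict_mono)
      have "(\<integral>\<^sup>+x. ennreal \<bar>conv \<eta> v x - conv \<eta> k x\<bar> \<partial>lborel) \<le> (\<integral>\<^sup>+x. ennreal \<bar>v x - k x\<bar> \<partial>lborel)"
        using nn_integral_conv_abs_le[OF \<eta>(1), of "\<lambda>x. v x - k x"] v ik by (simp add: conv_diff[OF t v ik])
      then show "(\<integral>\<^sup>+x. ennreal \<bar>conv \<eta> v x - conv \<eta> k x\<bar> \<partial>lborel) < ennreal (\<epsilon> / 3)"
        using k(3) by (rule le_less_trans)
      have a: "(\<integral>\<^sup>+x. ennreal \<bar>k x - v x\<bar> \<partial>lborel) < ennreal (\<epsilon> / 3)"
        using k(3) by (simp add: abs_minus_commute)
      have b: "(\<integral>\<^sup>+x. ennreal \<bar>conv \<eta> k x - k x\<bar> \<partial>lborel) \<le> ennreal (\<epsilon> / 3)"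
        using d(2)[OF \<eta>] .
      show "(\<integral>\<^sup>+x. ennreal \<bar>conv \<eta> k x - k x\<bar> \<partial>lborel) + (\<integral>\<^sup>+x. ennreal \<bar>k x - v x\<bar> \<partial>lborel)
        < ennreal (\<epsilon> / 3) + ennreal (\<epsilon> / 3)"
        using le_less_trans[OF add_right_mono[OF b]] a by (simp add: ennreal_add_left_cancel_less)
    qed
    also have "\<dots> = ennreal \<epsilon>" using \<epsilon> by (simp flip: ennreal_plus)
    finally show "(\<integral>\<^sup>+x. ennreal \<bar>conv \<eta> v x - v x\<bar> \<partial>lborel) < ennreal \<epsilon>" .
  qed (rule d)
qed

section \<open>Cut-offs and approximation of the absolute value\<close>

lemma locally_integrable_mult_test_fun:
  assumes "\<And>K. compact K \<Longrightarrow> set_integrable lborel K (u :: R3 \<Rightarrow> real)" "test_fun g"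
  shows "integrable lborel (\<lambda>x. g x * u x)"
proof -
  let ?K = "closure {x. g x \<noteq> 0}"
  obtain M where "\<And>x. \<bar>g x\<bar> \<le> M" using test_fun_bounded[OF assms(2)] by metis
  moreover have "integrable lborel (\<lambda>x. indicator ?K x *\<^sub>R u x)"
    using assms by (simp add: set_integrable_def test_fun_def)
  ultimately have "integrable lborel (\<lambda>x. g x * (indicator ?K x *\<^sub>R u x))"
    using assms(2) by (intro integrable_bounded_mult) (auto intro: smooth3_measurable test_funD)
  also have "(\<lambda>x. g x * (indicator ?K x *\<^sub>R u x)) = (\<lambda>x. g x * u x)"
    using closure_subset[of "{x. g x \<noteq> 0}"] by (auto simp: indicator_def fun_eq_iff)
  finally show ?thesis .
qed

text \<open>The weak equation for \<open>u\<close> is tested with the product of \<kappa> and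
  \<psi>, which is again a test function. This makes compactly supported copies of \<open>u\<close>
  available for mollification.\<close>

lemma weak_grad_mult_test_fun:
  assumes w: "weak_grad u G" and \<kappa>: "test_fun \<kappa>"
  shows "weak_grad (\<lambda>x. \<kappa> x * u x) (\<lambda>x. \<kappa> x *\<^sub>R G x + u x *\<^sub>R grad \<kappa> x)"
proof -
  note s = test_funD(1)[OF \<kappa>]
  have [measurable]: "u \<in> borel_measurable borel" "G \<in> borel_measurable borel"
    using w by (auto simp: weak_grad_def)
  have [measurable]: "\<kappa> \<in> borel_measurable borel" "grad \<kappa> \<in> borel_measurable borel"
    using s by (auto intro: smooth3_measurable measurable_grad)
  have u: "integrable lborel (\<lambda>x. g x * u x)" and G: "integrable lborel (\<lambda>x. g x * G x $ i)"
    if "test_fun g" for g i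
    using w that by (auto intro!: locally_integrable_mult_test_fun simp: weak_grad_def)
  have comp: "(\<kappa> x *\<^sub>R G x + u x *\<^sub>R grad \<kappa> x) $ i = \<kappa> x * G x $ i + partial i \<kappa> x * u x" for x i
    by (simp add: grad_def)
  have "set_integrable lborel K f" if "integrable lborel f" "compact K" for K and f :: "R3 \<Rightarrow> real"
    unfolding set_integrable_def using that by (intro integrable_mult_indicator) (auto intro: borel_compact)
  then have "set_integrable lborel K (\<lambda>x. \<kappa> x * u x)"
      "set_integrable lborel K (\<lambda>x. \<kappa> x * G x $ i + partial i \<kappa> x * u x)" if "compact K" for K i
    using u[OF \<kappa>] u[OF test_fun_partial[OF \<kappa>]] G[OF \<kappa>] that by auto
  moreover have "(\<integral>x. (\<kappa> x * u x) * partial i \<psi> x \<partial>lborel)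
      = - (\<integral>x. (\<kappa> x * G x $ i + partial i \<kappa> x * u x) * \<psi> x \<partial>lborel)" if \<psi>: "test_fun \<psi>" for \<psi> i
  proof -
    have t: "test_fun (\<lambda>x. \<kappa> x * \<psi> x)" using s \<psi> by (rule test_fun_mult)
    have t2: "test_fun (\<lambda>x. partial i \<kappa> x * \<psi> x)" using smooth3_partial[OF s] \<psi> by (rule test_fun_mult)
    have p: "partial i (\<lambda>x. \<kappa> x * \<psi> x) = (\<lambda>x. partial i \<kappa> x * \<psi> x + \<kappa> x * partial i \<psi> x)"
      using s \<psi> by (auto intro!: partial_mult smooth3_differentiable test_funD)
    have "(\<integral>x. u x * partial i (\<lambda>x. \<kappa> x * \<psi> x) x \<partial>lborel) = - (\<integral>x. G x $ i * (\<kappa> x * \<psi> x) \<partial>lborel)"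
      using w t by (auto simp: weak_grad_def)
    moreover have "(\<integral>x. (\<kappa> x * u x) * partial i \<psi> x \<partial>lborel)
        = (\<integral>x. partial i (\<lambda>x. \<kappa> x * \<psi> x) x * u x - (partial i \<kappa> x * \<psi> x) * u x \<partial>lborel)"
      by (rule Bochner_Integration.integral_cong) (auto simp: p algebra_simps)
    moreover have "(\<integral>x. (\<kappa> x * G x $ i + partial i \<kappa> x * u x) * \<psi> x \<partial>lborel)
        = (\<integral>x. (\<kappa> x * \<psi> x) * G x $ i + (partial i \<kappa> x * \<psi> x) * u x \<partial>lborel)"
      by (rule Bochner_Integration.integral_cong) (auto simp: algebra_simps)
    ultimately show ?thesis
      using u[OF test_fun_partial[OF t]] u[OF t2] G[OF t] by (simp add: mult.commute)
  qed
  ultimately show ?thesis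
    unfolding weak_grad_def comp by auto
qed

text \<open>Subtracting \<delta> restores the value 0 where \<open>g\<close> vanishes and hence the
  compact support. The chain rule factor t / sqrt (\<delta>^2 + t^2) has modulus at most 1, so no
  partial grows, and \<delta> > 0 keeps the square root away from its singularity.\<close>

lemma
  assumes g: "test_fun g" and d: "\<delta> > 0"
  shows test_fun_smooth_abs: "test_fun (\<lambda>x. sqrt (\<delta>\<^sup>2 + (g x)\<^sup>2) - \<delta>)"
    and partial_smooth_abs: "(partial i (\<lambda>x. sqrt (\<delta>\<^sup>2 + (g x)\<^sup>2) - \<delta>) x)\<^sup>2 \<le> (partial i g x)\<^sup>2"
proof -
  have pos: "\<delta>\<^sup>2 + t\<^sup>2 > 0" for t using d by (simp add: add_pos_nonneg)
  have "smooth3 (\<lambda>x. (\<delta>\<^sup>2 + (g x)\<^sup>2) powr (1 / 2) - \<delta>)"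
    using pos by (intro smooth3_diff smooth3_powr smooth3_add smooth3_const smooth3_power test_funD(1)[OF g])
  then have "smooth3 (\<lambda>x. sqrt (\<delta>\<^sup>2 + (g x)\<^sup>2) - \<delta>)"
    using pos by (simp add: powr_half_sqrt less_imp_le)
  moreover have "bounded {x. sqrt (\<delta>\<^sup>2 + (g x)\<^sup>2) - \<delta> \<noteq> 0}"
    by (rule bounded_subset[OF test_funD(2)[OF g]]) (use d in auto)
  ultimately show "test_fun (\<lambda>x. sqrt (\<delta>\<^sup>2 + (g x)\<^sup>2) - \<delta>)" by (simp add: test_fun_iff)
  let ?q = "g x / sqrt (\<delta>\<^sup>2 + (g x)\<^sup>2)"
  have "((\<lambda>t. sqrt (\<delta>\<^sup>2 + t\<^sup>2) - \<delta>) has_real_derivative ?q) (at (g x))"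
    using pos[of "g x"] by (auto intro!: derivative_eq_intros simp: field_simps)
  from partial_comp[OF this smooth3_differentiable[OF test_funD(1)[OF g]]]
  have "(partial i (\<lambda>x. sqrt (\<delta>\<^sup>2 + (g x)\<^sup>2) - \<delta>) x)\<^sup>2 = ?q\<^sup>2 * (partial i g x)\<^sup>2"
    by (simp add: power_mult_distrib power_divide)
  also have "?q\<^sup>2 \<le> 1"
    using pos[of "g x"] by (simp add: power_divide)
  then have "?q\<^sup>2 * (partial i g x)\<^sup>2 \<le> 1 * (partial i g x)\<^sup>2" by (rule mult_right_mono) simp
  finally show "(partial i (\<lambda>x. sqrt (\<delta>\<^sup>2 + (g x)\<^sup>2) - \<delta>) x)\<^sup>2 \<le> (partial i g x)\<^sup>2" by simp
qed

text \<open>Mollification followed by the smoothed absolute value. Neither operation increases the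
  L2 norm of the gradient, so the bound holds for each \<open>n\<close> with factor 1, and only
  pointwise convergence of the functions themselves is required.\<close>

lemma test_fun_approx_abs:
  assumes w: "weak_grad v G" and b: "bounded {x. v x \<noteq> 0}" and G: "L2vec G"
  obtains \<psi> where "\<And>n::nat. test_fun (\<psi> n)" "\<And>n x. 0 \<le> \<psi> n x"
    "AE x in lborel. (\<lambda>n. \<psi> n x) \<longlonglongrightarrow> \<bar>v x\<bar>"
    "\<And>n. (\<integral>x. (norm (grad (\<psi> n) x))\<^sup>2 \<partial>lborel) \<le> (\<integral>x. (norm (G x))\<^sup>2 \<partial>lborel)"
proof -
  have [measurable]: "v \<in> borel_measurable borel" "G \<in> borel_measurable borel"
    using w by (auto simp: weak_grad_def)
  have [measurable]: "(\<lambda>x. G x $ i) \<in> borel_measurable borel" for i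
    unfolding cart_eq_inner_axis by measurable
  have iG: "integrable lborel (\<lambda>x. (norm (G x))\<^sup>2)" using G by (simp add: L2vec_def)
  have iGi: "integrable lborel (\<lambda>x. (G x $ i)\<^sup>2)" for i
    by (rule Bochner_Integration.integrable_bound[OF iG])
       (auto simp: norm_power2_R3 abs_of_nonneg sum_nonneg intro!: member_le_sum)
  have v: "integrable lborel v"
  proof -
    have "set_integrable lborel (closure {x. v x \<noteq> 0}) v"
      using w b by (auto simp: weak_grad_def compact_closure)
    also have "(\<lambda>x. indicator (closure {x. v x \<noteq> 0}) x *\<^sub>R v x) = v"
      using closure_subset[of "{x. v x \<noteq> 0}"] by (auto simp: indicator_def fun_eq_iff)
    then have "set_integrable lborel (closure {x. v x \<noteq> 0}) v = integrable lborel v"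
      by (simp add: set_integrable_def)
    finally show ?thesis .
  qed
  have "\<exists>\<eta>. mollifier \<eta> \<and> (\<forall>x. norm x \<ge> 1 / real (Suc n) \<longrightarrow> \<eta> x = 0)" for n
    using mollifier_exists[of "1 / real (Suc n)"] by auto
  then obtain \<eta> where \<eta>: "\<And>n. mollifier (\<eta> n)" "\<And>n x. norm x \<ge> 1 / real (Suc n) \<Longrightarrow> \<eta> n x = 0"
    by metis
  let ?g = "\<lambda>n. conv (\<eta> n) v"
  have tg: "test_fun (?g n)" for n by (rule test_fun_conv[OF mollifierD(1)[OF \<eta>(1)] v b])
  have [measurable]: "?g n \<in> borel_measurable borel" for n
    using tg by (auto intro: smooth3_measurable test_funD)
  have ig: "integrable lborel (\<lambda>x. ?g n x - v x)" for n
    using test_fun_integrable[OF tg] v by simp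
  have "(\<lambda>n. \<integral>x. norm (?g n x - v x) \<partial>lborel) \<longlonglongrightarrow> 0"
  proof (rule LIMSEQ_I)
    fix \<epsilon> :: real assume e: "\<epsilon> > 0"
    obtain d where d: "d > 0" "\<And>\<eta>. mollifier \<eta> \<Longrightarrow> (\<And>x. norm x \<ge> d \<Longrightarrow> \<eta> x = 0) \<Longrightarrow>
      (\<integral>\<^sup>+x. ennreal \<bar>conv \<eta> v x - v x\<bar> \<partial>lborel) < ennreal \<epsilon>"
      using conv_L1_close[OF v e] by metis
    obtain N where N: "1 / real (Suc N) < d"
      using d(1) reals_Archimedean[of d] by (auto simp: inverse_eq_divide)
    have "(\<integral>x. norm (?g n x - v x) \<partial>lborel) < \<epsilon>" if "n \<ge> N" for n
    proof -
      have "1 / real (Suc n) \<le> 1 / real (Suc N)" using that by (intro divide_left_mono) auto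
      then have "(\<integral>\<^sup>+x. ennreal \<bar>?g n x - v x\<bar> \<partial>lborel) < ennreal \<epsilon>"
        using N by (intro d(2) \<eta>) auto
      moreover have "(\<integral>\<^sup>+x. ennreal \<bar>?g n x - v x\<bar> \<partial>lborel) = ennreal (\<integral>x. norm (?g n x - v x) \<partial>lborel)"
        using ig[of n] by (subst nn_integral_eq_integral) auto
      ultimately show ?thesis by (simp add: ennreal_less_iff)
    qed
    then show "\<exists>N. \<forall>n\<ge>N. norm ((\<integral>x. norm (?g n x - v x) \<partial>lborel) - 0) < \<epsilon>"
      by (intro exI[of _ N]) simp
  qed
  \<comment> \<open>L1 convergence gives almost everywhere convergence only along a subsequence;
    this is harmless, because the gradient bound holds for every mollifier.\<close>
  from tendsto_L1_AE_subseq[OF ig this] obtain r where r: "strict_mono r"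
    "AE x in lborel. (\<lambda>n. ?g (r n) x - v x) \<longlonglongrightarrow> 0" by auto
  define \<delta> where "\<delta> n = 1 / real (Suc n)" for n
  have \<delta>: "\<delta> n > 0" for n by (simp add: \<delta>_def)
  have \<delta>0: "\<delta> \<longlonglongrightarrow> 0" unfolding \<delta>_def[abs_def] by (rule LIMSEQ_Suc) (rule lim_1_over_n)
  define \<psi> where "\<psi> n x = sqrt ((\<delta> n)\<^sup>2 + (?g (r n) x)\<^sup>2) - \<delta> n" for n x
  have t: "test_fun (\<psi> n)" for n
    unfolding \<psi>_def[abs_def] by (rule test_fun_smooth_abs[OF tg \<delta>])
  show ?thesis
  proof (rule that[OF t])
    show "0 \<le> \<psi> n x" for n x
      using \<delta>[of n] real_sqrt_le_mono[of "(\<delta> n)\<^sup>2" "(\<delta> n)\<^sup>2 + (?g (r n) x)\<^sup>2"] by (simp add: \<psi>_def)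
    show "AE x in lborel. (\<lambda>n. \<psi> n x) \<longlonglongrightarrow> \<bar>v x\<bar>"
      using r(2)
    proof eventually_elim
      case (elim x)
      then have "(\<lambda>n. ?g (r n) x) \<longlonglongrightarrow> v x" by (rule LIM_zero_cancel)
      with \<delta>0 have "(\<lambda>n. \<psi> n x) \<longlonglongrightarrow> sqrt (0\<^sup>2 + (v x)\<^sup>2) - 0"
        unfolding \<psi>_def by (intro tendsto_intros)
      then show ?case by simp
    qed
    fix n
    have "ennreal (\<integral>x. (norm (grad (\<psi> n) x))\<^sup>2 \<partial>lborel) = (\<integral>\<^sup>+x. ennreal ((norm (grad (\<psi> n) x))\<^sup>2) \<partial>lborel)"
      using integrable_grad_power2[OF t] by (intro nn_integral_eq_integral[symmetric]) auto
    also have "\<dots> \<le> (\<integral>\<^sup>+x. (\<Sum>i\<in>UNIV. ennreal ((conv (\<eta> (r n)) (\<lambda>y. G y $ i) x)\<^sup>2)) \<partial>lborel)"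
    proof (rule nn_integral_mono)
      fix x
      have "(norm (grad (\<psi> n) x))\<^sup>2 \<le> (\<Sum>i\<in>UNIV. (partial i (?g (r n)) x)\<^sup>2)"
        unfolding norm_grad_power2 \<psi>_def[abs_def] by (intro sum_mono partial_smooth_abs tg \<delta>)
      also have "\<dots> = (\<Sum>i\<in>UNIV. (conv (\<eta> (r n)) (\<lambda>y. G y $ i) x)\<^sup>2)"
        by (simp add: partial_conv_weak_grad[OF mollifierD(1)[OF \<eta>(1)] v w])
      finally show "ennreal ((norm (grad (\<psi> n) x))\<^sup>2) \<le> (\<Sum>i\<in>UNIV. ennreal ((conv (\<eta> (r n)) (\<lambda>y. G y $ i) x)\<^sup>2))"
        by (simp add: ennreal_leI)
    qed
    also have "\<dots> = (\<Sum>i\<in>UNIV. \<integral>\<^sup>+x. ennreal ((conv (\<eta> (r n)) (\<lambda>y. G y $ i) x)\<^sup>2) \<partial>lborel)"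
    proof (rule nn_integral_sum)
      fix i
      have "partial i (?g (r n)) = conv (\<eta> (r n)) (\<lambda>y. G y $ i)"
        using partial_conv_weak_grad[OF mollifierD(1)[OF \<eta>(1)] v w] by auto
      moreover have "partial i (?g (r n)) \<in> borel_measurable borel"
        using tg by (auto intro: smooth3_measurable smooth3_partial test_funD)
      ultimately have [measurable]: "conv (\<eta> (r n)) (\<lambda>y. G y $ i) \<in> borel_measurable borel" by simp
      show "(\<lambda>x. ennreal ((conv (\<eta> (r n)) (\<lambda>y. G y $ i) x)\<^sup>2)) \<in> borel_measurable lborel" by measurable
    qed
    \<comment> \<open>The scalar Jensen estimate is applied to each component of \<open>G\<close>;
      the squared components then add up to the squared norm.\<close>
    also have "\<dots> \<le> (\<Sum>i\<in>UNIV. \<integral>\<^sup>+x. ennreal ((G x $ i)\<^sup>2) \<partial>lborel)"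
      by (intro sum_mono nn_integral_conv_power2_le \<eta> iGi) measurable
    also have "\<dots> = (\<integral>\<^sup>+x. (\<Sum>i\<in>UNIV. ennreal ((G x $ i)\<^sup>2)) \<partial>lborel)"
      by (rule nn_integral_sum[symmetric]) measurable
    also have "\<dots> = (\<integral>\<^sup>+x. ennreal ((norm (G x))\<^sup>2) \<partial>lborel)"
      by (simp add: norm_power2_R3)
    also have "\<dots> = ennreal (\<integral>x. (norm (G x))\<^sup>2 \<partial>lborel)"
      using iG by (intro nn_integral_eq_integral) auto
    finally show "(\<integral>x. (norm (grad (\<psi> n) x))\<^sup>2 \<partial>lborel) \<le> (\<integral>x. (norm (G x))\<^sup>2 \<partial>lborel)"
      by (simp add: ennreal_le_iff)
  qed
qed

section \<open>The energy argument\<close>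

text \<open>A bump normalised to 1 at the origin and stretched by the factor n + 1, which divides
  its gradient by n + 1.\<close>

lemma cutoff_exists:
  "\<exists>\<kappa> C. \<forall>n::nat. test_fun (\<kappa> n) \<and> (\<forall>x. 0 \<le> \<kappa> n x \<and> \<kappa> n x \<le> 1 \<and>
    norm (grad (\<kappa> n) x) \<le> C / real (Suc n) \<and> (\<lambda>m. \<kappa> m x) \<longlonglongrightarrow> 1)"
proof -
  define b where "b x = (1 / bump 0) * bump x" for x
  have t: "test_fun b" unfolding b_def[abs_def] by (intro test_fun_mult smooth3_const test_fun_bump)
  have b: "0 \<le> b x" "b x \<le> 1" "b 0 = 1" for x
    using bump_nonneg[of x] bump_le[of x] bump_0 by (auto simp: b_def)
  obtain C where C: "\<And>x. norm (grad b x) \<le> C" using test_fun_grad_bounded[OF t] by metis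
  define \<kappa> where "\<kappa> n = (\<lambda>x. b (0 + (1 / real (Suc n)) *\<^sub>R x))" for n :: nat
  show ?thesis
  proof (intro exI[of _ \<kappa>] exI[of _ C] allI conjI)
    show "test_fun (\<kappa> n)" for n unfolding \<kappa>_def by (rule test_fun_affine[OF t]) simp
    show "0 \<le> \<kappa> n x" "\<kappa> n x \<le> 1" for n x by (simp_all add: \<kappa>_def b)
    show "(\<lambda>n. \<kappa> n x) \<longlonglongrightarrow> 1" for x
    proof -
      have "(\<lambda>n. 1 / real (Suc n)) \<longlonglongrightarrow> 0" by (rule LIMSEQ_Suc) (rule lim_1_over_n)
      then have "(\<lambda>n. 0 + (1 / real (Suc n)) *\<^sub>R x) \<longlonglongrightarrow> 0 + 0 *\<^sub>R x" by (intro tendsto_intros)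
      then have "(\<lambda>n. b (0 + (1 / real (Suc n)) *\<^sub>R x)) \<longlonglongrightarrow> b (0 + 0 *\<^sub>R x)"
        by (rule isCont_tendsto_compose[rotated])
           (rule differentiable_imp_continuous_within[OF smooth3_differentiable[OF test_funD(1)[OF t]]])
      then show ?thesis by (simp add: \<kappa>_def b(3))
    qed
    show "norm (grad (\<kappa> n) x) \<le> C / real (Suc n)" for n x
    proof -
      have "grad (\<kappa> n) x = (1 / real (Suc n)) *\<^sub>R grad b (0 + (1 / real (Suc n)) *\<^sub>R x)"
        using partial_affine(1)[OF smooth3_differentiable[OF test_funD(1)[OF t]], where a = 0 and c = "1 / real (Suc n)"]
        by (simp add: \<kappa>_def grad_def vec_eq_iff)
      then show ?thesis
        using C[of "0 + (1 / real (Suc n)) *\<^sub>R x"] by (simp add: divide_right_mono)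
    qed
  qed
qed

text \<open>Young's inequality with weight \<open>n\<close>: (a + b)^2 is at most (1 + 1/n) a^2 + (1
  + n) b^2. Since b is of order 1/n, the second term is still of order 1/n. The cruder 2 a^2 + 2 b^2
  would double the gradient term in the limit and lose the sharp constant.\<close>

lemma norm_cutoff_power2_le:
  fixes G H :: R3
  assumes "0 \<le> k" "k \<le> 1" "norm H \<le> C / n" "1 \<le> (n::real)"
  shows "(norm (k *\<^sub>R G + u *\<^sub>R H))\<^sup>2 \<le> (1 + 1 / n) * (norm G)\<^sup>2 + 2 * C\<^sup>2 / n * u\<^sup>2"
proof -
  define a b where "a = norm G" and "b = \<bar>u\<bar> * (C / n)"
  have "norm (k *\<^sub>R G + u *\<^sub>R H) \<le> k * a + \<bar>u\<bar> * norm H"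
    using norm_triangle_ineq[of "k *\<^sub>R G" "u *\<^sub>R H"] assms(1) by (simp add: a_def)
  also have "\<dots> \<le> 1 * a + b"
    unfolding b_def using assms by (intro add_mono mult_mono) (auto simp: a_def)
  finally have "(norm (k *\<^sub>R G + u *\<^sub>R H))\<^sup>2 \<le> (a + b)\<^sup>2"
    by (intro power_mono) auto
  also have "\<dots> \<le> (1 + 1 / n) * a\<^sup>2 + (1 + n) * b\<^sup>2"
  proof -
    have "0 \<le> (a - n * b)\<^sup>2 / n" using assms(4) by simp
    also have "(a - n * b)\<^sup>2 / n = (1 + 1 / n) * a\<^sup>2 + (1 + n) * b\<^sup>2 - (a + b)\<^sup>2"
      using assms(4) by (simp add: field_simps power2_eq_square)
    finally show ?thesis by simp
  qed
  also have "(1 + n) * b\<^sup>2 \<le> 2 * n * b\<^sup>2"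
    using assms(4) by (intro mult_right_mono) auto
  also have "2 * n * b\<^sup>2 = 2 * C\<^sup>2 / n * u\<^sup>2"
    using assms(4) by (simp add: b_def power_mult_distrib power_divide power2_eq_square)
  finally show ?thesis by (simp add: a_def)
qed

lemma integrable_power2_mult_test_fun:
  assumes "L2 u" "test_fun \<psi>" shows "integrable lborel (\<lambda>x. (u x)\<^sup>2 * \<psi> x)"
proof -
  obtain M where "\<And>x. \<bar>\<psi> x\<bar> \<le> M" using test_fun_bounded[OF assms(2)] by metis
  then have "integrable lborel (\<lambda>x. \<psi> x * (u x)\<^sup>2)"
    using assms by (intro integrable_bounded_mult) (auto simp: L2_def intro: smooth3_measurable test_funD)
  then show ?thesis by (simp add: mult.commute)
qed

text \<open>Fatou's lemma along nonnegative test functions yields the integrability of \<open>\<bar>u\<bar>\<^sup>3\<close> as well,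
  so the Sobolev embedding is not needed.\<close>
lemma cubic_integral_le:
  assumes H: "H1_grad u G" and c: "c > 0" and A: "A \<ge> 0"
    and le: "\<And>\<psi>. test_fun \<psi> \<Longrightarrow> c * (\<integral>x. (u x)\<^sup>2 * \<psi> x \<partial>lborel) \<le> (\<integral>x. (norm (grad \<psi> x))\<^sup>2 \<partial>lborel) + A"
  shows "integrable lborel (\<lambda>x. \<bar>u x\<bar> ^ 3)"
    and "c * (\<integral>x. \<bar>u x\<bar> ^ 3 \<partial>lborel) \<le> (\<integral>x. (norm (G x))\<^sup>2 \<partial>lborel) + A"
proof -
  have u: "L2 u" and w: "weak_grad u G" and G: "L2vec G" using H by (auto simp: H1_grad_def)
  have [measurable]: "u \<in> borel_measurable borel" "G \<in> borel_measurable borel"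
    using w by (auto simp: weak_grad_def)
  have iG: "integrable lborel (\<lambda>x. (norm (G x))\<^sup>2)" using G by (simp add: L2vec_def)
  have iu: "integrable lborel (\<lambda>x. (u x)\<^sup>2)" using u by (simp add: L2_def)
  \<comment> \<open>Only the third factor is approximated; the square of \<open>u\<close> stays a
    fixed weight. A nonnegative integral is used because finiteness is part of what is being
    shown.\<close>
  have compact_case: "(\<integral>\<^sup>+x. ennreal (c * ((u x)\<^sup>2 * \<bar>v x\<bar>)) \<partial>lborel) \<le> ennreal ((\<integral>x. (norm (Gv x))\<^sup>2 \<partial>lborel) + A)"
    if v: "weak_grad v Gv" "bounded {x. v x \<noteq> 0}" "L2vec Gv" for v Gv
  proof -
    obtain \<psi> where \<psi>: "\<And>n::nat. test_fun (\<psi> n)" "\<And>n x. 0 \<le> \<psi> n x"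
      "AE x in lborel. (\<lambda>n. \<psi> n x) \<longlonglongrightarrow> \<bar>v x\<bar>"
      "\<And>n. (\<integral>x. (norm (grad (\<psi> n) x))\<^sup>2 \<partial>lborel) \<le> (\<integral>x. (norm (Gv x))\<^sup>2 \<partial>lborel)"
      by (rule test_fun_approx_abs[OF v]) (rule that)
    have [measurable]: "\<psi> n \<in> borel_measurable borel" for n
      using \<psi>(1) by (auto intro: smooth3_measurable test_funD)
    have "(\<integral>\<^sup>+x. ennreal (c * ((u x)\<^sup>2 * \<bar>v x\<bar>)) \<partial>lborel)
        = (\<integral>\<^sup>+x. liminf (\<lambda>n. ennreal (c * ((u x)\<^sup>2 * \<psi> n x))) \<partial>lborel)"
    proof (rule nn_integral_cong_AE)
      show "AE x in lborel. ennreal (c * ((u x)\<^sup>2 * \<bar>v x\<bar>)) = liminf (\<lambda>n. ennreal (c * ((u x)\<^sup>2 * \<psi> n x)))"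
        using \<psi>(3)
      proof eventually_elim
        case (elim x)
        then have "(\<lambda>n. ennreal (c * ((u x)\<^sup>2 * \<psi> n x))) \<longlonglongrightarrow> ennreal (c * ((u x)\<^sup>2 * \<bar>v x\<bar>))"
          by (intro tendsto_intros)
        then show ?case by (simp add: lim_imp_Liminf)
      qed
    qed
    also have "\<dots> \<le> liminf (\<lambda>n. \<integral>\<^sup>+x. ennreal (c * ((u x)\<^sup>2 * \<psi> n x)) \<partial>lborel)"
      by (rule nn_integral_liminf) measurable
    also have "\<dots> \<le> liminf (\<lambda>n::nat. ennreal ((\<integral>x. (norm (Gv x))\<^sup>2 \<partial>lborel) + A))"
    proof (rule Liminf_mono, rule always_eventually, rule allI)
      fix n
      have "(\<integral>\<^sup>+x. ennreal (c * ((u x)\<^sup>2 * \<psi> n x)) \<partial>lborel) = ennreal (c * (\<integral>x. (u x)\<^sup>2 * \<psi> n x \<partial>lborel))"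
        using integrable_power2_mult_test_fun[OF u \<psi>(1)] \<psi>(2) c
        by (subst nn_integral_eq_integral) auto
      also have "\<dots> \<le> ennreal ((\<integral>x. (norm (Gv x))\<^sup>2 \<partial>lborel) + A)"
        using le[OF \<psi>(1)[of n]] \<psi>(4)[of n] by (intro ennreal_leI) linarith
      finally show "(\<integral>\<^sup>+x. ennreal (c * ((u x)\<^sup>2 * \<psi> n x)) \<partial>lborel) \<le> ennreal ((\<integral>x. (norm (Gv x))\<^sup>2 \<partial>lborel) + A)" .
    qed
    finally show ?thesis by (simp only: Liminf_const[OF sequentially_bot])
  qed
  \<comment> \<open>A second passage to the limit removes the compact support: the cut-off products
    with \<open>u\<close> take the place of \<open>v\<close>, and the errors caused by grad \<kappa>
    disappear in the limit of \<open>E\<close>.\<close>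
  obtain \<kappa> C where \<kappa>: "\<And>n::nat. test_fun (\<kappa> n)" "\<And>n x. 0 \<le> \<kappa> n x" "\<And>n x. \<kappa> n x \<le> 1"
    "\<And>x. (\<lambda>n. \<kappa> n x) \<longlonglongrightarrow> 1" "\<And>n x. norm (grad (\<kappa> n) x) \<le> C / real (Suc n)"
    using cutoff_exists by blast
  have [measurable]: "\<kappa> n \<in> borel_measurable borel" "grad (\<kappa> n) \<in> borel_measurable borel" for n
    using \<kappa>(1) by (auto intro: smooth3_measurable measurable_grad test_funD)
  define I J where "I = (\<integral>x. (norm (G x))\<^sup>2 \<partial>lborel)" and "J = (\<integral>x. (u x)\<^sup>2 \<partial>lborel)"
  define E where "E n = (1 + 1 / real (Suc n)) * I + 2 * C\<^sup>2 / real (Suc n) * J + A" for n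
  have step: "(\<integral>\<^sup>+x. ennreal (c * ((u x)\<^sup>2 * \<bar>\<kappa> n x * u x\<bar>)) \<partial>lborel) \<le> ennreal (E n)" for n
  proof -
    let ?Gv = "\<lambda>x. \<kappa> n x *\<^sub>R G x + u x *\<^sub>R grad (\<kappa> n) x"
    let ?bd = "\<lambda>x. (1 + 1 / real (Suc n)) * (norm (G x))\<^sup>2 + 2 * C\<^sup>2 / real (Suc n) * (u x)\<^sup>2"
    have ptw: "(norm (?Gv x))\<^sup>2 \<le> ?bd x" for x
      using \<kappa> by (intro norm_cutoff_power2_le) auto
    have ibd: "integrable lborel ?bd" using iG iu by (intro Bochner_Integration.integrable_add integrable_mult_right)
    have iGv: "integrable lborel (\<lambda>x. (norm (?Gv x))\<^sup>2)"
      by (rule Bochner_Integration.integrable_bound[OF ibd])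
         (measurable, use order_trans[OF ptw abs_ge_self] in auto)
    have "L2vec ?Gv" unfolding L2vec_def using iGv by auto
    moreover have "bounded {x. \<kappa> n x * u x \<noteq> 0}"
      by (rule bounded_subset[OF test_funD(2)[OF \<kappa>(1)[of n]]]) auto
    ultimately have "(\<integral>\<^sup>+x. ennreal (c * ((u x)\<^sup>2 * \<bar>\<kappa> n x * u x\<bar>)) \<partial>lborel) \<le> ennreal ((\<integral>x. (norm (?Gv x))\<^sup>2 \<partial>lborel) + A)"
      using weak_grad_mult_test_fun[OF w \<kappa>(1)] by (intro compact_case)
    also have "(\<integral>x. (norm (?Gv x))\<^sup>2 \<partial>lborel) \<le> (\<integral>x. ?bd x \<partial>lborel)"
      using iGv ibd ptw by (rule integral_mono)
    then have "ennreal ((\<integral>x. (norm (?Gv x))\<^sup>2 \<partial>lborel) + A) \<le> ennreal ((\<integral>x. ?bd x \<partial>lborel) + A)"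
      by (intro ennreal_leI) simp
    also have "(\<integral>x. ?bd x \<partial>lborel) + A = E n"
      unfolding E_def I_def J_def using iG iu
      by (subst Bochner_Integration.integral_add) (auto intro: integrable_mult_right)
    finally show ?thesis .
  qed
  have "(\<lambda>n. 1 / real (Suc n)) \<longlonglongrightarrow> 0" by (rule LIMSEQ_Suc) (rule lim_1_over_n)
  then have "(\<lambda>n. (1 + 1 / real (Suc n)) * I + 2 * C\<^sup>2 * (1 / real (Suc n)) * J + A) \<longlonglongrightarrow> (1 + 0) * I + 2 * C\<^sup>2 * 0 * J + A"
    by (intro tendsto_intros)
  then have E: "E \<longlonglongrightarrow> I + A" by (simp add: E_def[abs_def])
  have "(\<integral>\<^sup>+x. ennreal (c * \<bar>u x\<bar> ^ 3) \<partial>lborel)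
      = (\<integral>\<^sup>+x. liminf (\<lambda>n. ennreal (c * ((u x)\<^sup>2 * \<bar>\<kappa> n x * u x\<bar>))) \<partial>lborel)"
  proof (rule nn_integral_cong)
    fix x
    have "(\<lambda>n. ennreal (c * ((u x)\<^sup>2 * \<bar>\<kappa> n x * u x\<bar>))) \<longlonglongrightarrow> ennreal (c * ((u x)\<^sup>2 * \<bar>1 * u x\<bar>))"
      by (intro tendsto_intros \<kappa>(4))
    moreover have "(u x)\<^sup>2 * \<bar>1 * u x\<bar> = \<bar>u x\<bar> ^ 3"
      by (simp add: power2_eq_square power3_eq_cube flip: abs_mult)
    ultimately show "ennreal (c * \<bar>u x\<bar> ^ 3) = liminf (\<lambda>n. ennreal (c * ((u x)\<^sup>2 * \<bar>\<kappa> n x * u x\<bar>)))"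
      by (simp add: lim_imp_Liminf)
  qed
  also have "\<dots> \<le> liminf (\<lambda>n. \<integral>\<^sup>+x. ennreal (c * ((u x)\<^sup>2 * \<bar>\<kappa> n x * u x\<bar>)) \<partial>lborel)"
    by (rule nn_integral_liminf) measurable
  also have "\<dots> \<le> liminf (\<lambda>n. ennreal (E n))"
    by (rule Liminf_mono) (simp add: step)
  also have "\<dots> = ennreal (I + A)"
    using E by (intro lim_imp_Liminf tendsto_ennrealI) auto
  finally have fin: "(\<integral>\<^sup>+x. ennreal (c * \<bar>u x\<bar> ^ 3) \<partial>lborel) \<le> ennreal (I + A)" .
  have ic: "integrable lborel (\<lambda>x. c * \<bar>u x\<bar> ^ 3)"
    using c le_less_trans[OF fin ennreal_less_top]
    by (intro integrableI_bounded) (auto simp: abs_mult)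
  then have "integrable lborel (\<lambda>x. (1 / c) * (c * \<bar>u x\<bar> ^ 3))" by (rule integrable_mult_right)
  then show "integrable lborel (\<lambda>x. \<bar>u x\<bar> ^ 3)" using c by simp
  have "ennreal (\<integral>x. c * \<bar>u x\<bar> ^ 3 \<partial>lborel) \<le> ennreal (I + A)"
    using fin ic c by (subst (asm) nn_integral_eq_integral) auto
  moreover have "0 \<le> I + A" using A by (simp add: I_def)
  ultimately show "c * (\<integral>x. \<bar>u x\<bar> ^ 3 \<partial>lborel) \<le> (\<integral>x. (norm (G x))\<^sup>2 \<partial>lborel) + A"
    by (simp add: ennreal_le_iff I_def)
qed

section \<open>Pointwise bounds for the nonlinearity and the coefficient\<close>

lemma quotient_bounded:
  fixes f :: "real \<Rightarrow> real"
  assumes f: "continuous_on UNIV f"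
    and f1: "((\<lambda>s. f s / s) \<longlongrightarrow> 0) at_infinity" and f2: "((\<lambda>s. f s / s) \<longlongrightarrow> 0) (at 0)"
  obtains M where "\<And>s. s \<noteq> 0 \<Longrightarrow> \<bar>f s / s\<bar> \<le> M"
proof -
  have "\<forall>\<^sub>F s in at_infinity. dist (f s / s) 0 < 1" using f1 by (rule tendstoD) simp
  then obtain B where B: "\<And>s. \<bar>s\<bar> \<ge> B \<Longrightarrow> \<bar>f s / s\<bar> < 1"
    by (auto simp: eventually_at_infinity)
  have "\<forall>\<^sub>F s in at 0. dist (f s / s) 0 < 1" using f2 by (rule tendstoD) simp
  then obtain d where d: "d > 0" "\<And>s. s \<noteq> 0 \<Longrightarrow> \<bar>s\<bar> < d \<Longrightarrow> \<bar>f s / s\<bar> < 1"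
    by (auto simp: eventually_at dist_real_def)
  \<comment> \<open>The two limits bound the quotient by 1 near 0 and near infinity; what remains is
    compact and avoids 0, so continuity bounds the quotient there.\<close>
  let ?K = "cball (0::real) B - ball 0 d"
  have "compact ?K" by (intro compact_diff) auto
  moreover have "continuous_on ?K (\<lambda>s. f s / s)"
    using d(1) by (intro continuous_intros continuous_on_subset[OF f]) auto
  ultimately have "bounded ((\<lambda>s. f s / s) ` ?K)"
    by (intro compact_imp_bounded compact_continuous_image)
  then obtain M where "\<forall>y\<in>(\<lambda>s. f s / s) ` ?K. norm y \<le> M"
    unfolding bounded_iff by blast
  then have M: "\<bar>f s / s\<bar> \<le> M" if "s \<in> ?K" for s
    using that unfolding real_norm_def by blast
  have "\<bar>f s / s\<bar> \<le> max 1 M" if "s \<noteq> 0" for s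
    using B[of s] d(2)[OF that] M[of s] by (cases "s \<in> ?K") (auto simp: dist_real_def)
  then show ?thesis by (rule that)
qed

text \<open>A real \<open>Sup\<close> is an upper bound only if the set is bounded above; dropping
  the quadratic term of the denominator reduces this to \<open>quotient_bounded\<close>. The extra
  factor |s| fits the integrand that arises when the first equation is tested with
  \<open>u\<close>.\<close>

lemma abs_le_c_f:
  assumes e: "e > 0" and f: "continuous_on UNIV f"
    and f1: "((\<lambda>s. f s / s) \<longlongrightarrow> 0) at_infinity" and f2: "((\<lambda>s. f s / s) \<longlongrightarrow> 0) (at 0)"
  shows "\<bar>f s\<bar> * \<bar>s\<bar> \<le> c_f e f * (s\<^sup>2 + 4 * sqrt pi * e * \<bar>s\<bar> ^ 3)"
proof (cases "s = 0")
  case False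
  let ?q = "\<lambda>s. \<bar>f s\<bar> / (\<bar>s\<bar> + 4 * sqrt pi * e * s\<^sup>2)"
  obtain M where M: "\<And>s. s \<noteq> 0 \<Longrightarrow> \<bar>f s / s\<bar> \<le> M" using quotient_bounded[OF f f1 f2] by metis
  have "?q t \<le> M" if "t \<noteq> 0" for t
  proof -
    have "?q t \<le> \<bar>f t\<bar> / \<bar>t\<bar>" using that e by (intro divide_left_mono) (auto intro!: add_pos_nonneg mult_pos_pos)
    with M[OF that] show ?thesis by simp
  qed
  then have "bdd_above (?q ` (UNIV - {0}))" by (intro bdd_aboveI2[of _ _ M]) auto
  then have "?q s \<le> c_f e f" unfolding c_f_def using False by (intro cSUP_upper) auto
  moreover have pos: "\<bar>s\<bar> + 4 * sqrt pi * e * s\<^sup>2 > 0" using False e by (intro add_pos_nonneg) auto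
  ultimately have "\<bar>f s\<bar> \<le> c_f e f * (\<bar>s\<bar> + 4 * sqrt pi * e * s\<^sup>2)" by (simp add: pos_divide_le_eq)
  then have "\<bar>f s\<bar> * \<bar>s\<bar> \<le> c_f e f * (\<bar>s\<bar> + 4 * sqrt pi * e * s\<^sup>2) * \<bar>s\<bar>" by (rule mult_right_mono) simp
  also have "\<dots> = c_f e f * (s\<^sup>2 + 4 * sqrt pi * e * \<bar>s\<bar> ^ 3)"
  proof -
    have "\<bar>s\<bar> * \<bar>s\<bar> = s\<^sup>2" "s\<^sup>2 * \<bar>s\<bar> = \<bar>s\<bar> ^ 3"
      by (simp_all add: power2_eq_square power3_eq_cube flip: abs_mult)
    then show ?thesis by (simp add: distrib_left distrib_right mult.assoc)
  qed
  finally show ?thesis .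
qed simp

text \<open>\<open>Linf\<close> makes the essential supremum less than infinity, so
  \<open>real_of_ereal\<close> does not replace an infinite value by 0.\<close>

lemma AE_abs_le_norm_inf:
  assumes "Linf \<alpha>" shows "AE x in lborel. \<bar>\<alpha> x\<bar> \<le> norm_inf \<alpha>"
  using esssup_AE[of "\<lambda>x. ereal \<bar>\<alpha> x\<bar>" lborel]
proof eventually_elim
  case (elim x)
  with assms show ?case
    unfolding Linf_def norm_inf_def by (cases "esssup lborel (\<lambda>x. ereal \<bar>\<alpha> x\<bar>)") auto
qed

theorem theorem1p1:
  fixes e lam :: real and f :: "real \<Rightarrow> real" and \<alpha> u \<phi> :: "R3 \<Rightarrow> real"
  assumes e_pos: "e > 0"
    and f_cont: "continuous_on UNIV f"
    and f1: "((\<lambda>s. f s / s) \<longlongrightarrow> 0) at_infinity"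
    and f2: "((\<lambda>s. f s / s) \<longlongrightarrow> 0) (at 0)"
    and f3: "\<exists>s0::real. (LBINT t=ereal 0..ereal s0. f t) > 0"
    and alpha: "Linf \<alpha>"
    and lam: "0 \<le> lam" "lam * norm_inf \<alpha> * c_f e f < 1"
    and sol: "weak_solution e lam \<alpha> f u \<phi>"
  shows "AE x in lborel. u x = 0 \<and> \<phi> x = 0"
proof -
  obtain Gu G\<phi> where H: "H1_grad u Gu" and D: "D12_grad \<phi> G\<phi>"
    and eq1: "\<And>v Gv. H1_grad v Gv \<Longrightarrow>
          (\<integral>x. Gu x \<bullet> Gv x + u x * v x + e * \<phi> x * u x * v x \<partial>lborel)
            = lam * (\<integral>x. \<alpha> x * f (u x) * v x \<partial>lborel)"
    and eq2: "\<And>\<psi> G\<psi>. D12_grad \<psi> G\<psi> \<Longrightarrow>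
          (\<integral>x. G\<phi> x \<bullet> G\<psi> x \<partial>lborel) = 4 * pi * e * (\<integral>x. (u x)\<^sup>2 * \<psi> x \<partial>lborel)"
    using sol unfolding weak_solution_def by blast
  have [measurable]: "u \<in> borel_measurable borel" "Gu \<in> borel_measurable borel"
    "\<phi> \<in> borel_measurable borel" "G\<phi> \<in> borel_measurable borel"
    using H D by (auto simp: H1_grad_def D12_grad_def weak_grad_def)
  have iu: "integrable lborel (\<lambda>x. (u x)\<^sup>2)" and iGu: "integrable lborel (\<lambda>x. (norm (Gu x))\<^sup>2)"
    and iG\<phi>: "integrable lborel (\<lambda>x. (norm (G\<phi> x))\<^sup>2)"
    using H D by (auto simp: H1_grad_def D12_grad_def L2_def L2vec_def)
  define I J K S Q where "I = (\<integral>x. (norm (Gu x))\<^sup>2 \<partial>lborel)" and "J = (\<integral>x. (u x)\<^sup>2 \<partial>lborel)"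
    and "K = (\<integral>x. (norm (G\<phi> x))\<^sup>2 \<partial>lborel)" and "S = (\<integral>x. (u x)\<^sup>2 * \<phi> x \<partial>lborel)"
    and "Q = (\<integral>x. \<bar>u x\<bar> ^ 3 \<partial>lborel)"
  have nonneg: "I \<ge> 0" "J \<ge> 0" "K \<ge> 0" "Q \<ge> 0"
    by (simp_all add: I_def J_def K_def Q_def)
  \<comment> \<open>Needed twice: for the conclusion on \<phi>, and to rule out a non-integrable
    coupling term.\<close>
  have K0: "AE x in lborel. \<phi> x = 0" if "K = 0"
  proof -
    have "AE x in lborel. (norm (G\<phi> x))\<^sup>2 = 0"
      using that integral_nonneg_eq_0_iff_AE[OF iG\<phi>] by (simp add: K_def)
    then have "AE x in lborel. G\<phi> x = 0" by simp
    then show ?thesis by (rule D12_grad_zero_imp_zero[OF D])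
  qed
  have KS: "K = 4 * pi * e * S"
    using eq2[OF D] by (simp add: K_def S_def power2_norm_eq_inner)
  \<comment> \<open>Otherwise the right-hand side of the second equation is the junk value 0, which forces \<open>\<phi> = 0\<close>.\<close>
  have iS: "integrable lborel (\<lambda>x. (u x)\<^sup>2 * \<phi> x)"
  proof (rule ccontr)
    assume n: "\<not> integrable lborel (\<lambda>x. (u x)\<^sup>2 * \<phi> x)"
    then have "K = 0" using KS by (simp add: S_def not_integrable_integral_eq)
    then have "AE x in lborel. (u x)\<^sup>2 * \<phi> x = 0" using K0 by auto
    then have "integrable lborel (\<lambda>x. (u x)\<^sup>2 * \<phi> x) \<longleftrightarrow> integrable lborel (\<lambda>x::R3. 0::real)"
      by (intro integrable_cong_AE) auto
    with n show False by simp
  qed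
  have test: "4 * sqrt pi * e * (\<integral>x. (u x)\<^sup>2 * \<psi> x \<partial>lborel)
      \<le> (\<integral>x. (norm (grad \<psi> x))\<^sup>2 \<partial>lborel) + K / (4 * pi)" if \<psi>: "test_fun \<psi>" for \<psi>
  proof -
    have [measurable]: "grad \<psi> \<in> borel_measurable borel" using \<psi> by (auto intro: measurable_grad test_funD)
    have ptw: "(1 / sqrt pi) * \<bar>G\<phi> x \<bullet> grad \<psi> x\<bar> \<le> (norm (grad \<psi> x))\<^sup>2 + (1 / (4 * pi)) * (norm (G\<phi> x))\<^sup>2" for x
    proof -
      \<comment> \<open>With b = |grad phi| / sqrt pi, the term b^2 / 4 carries the factor 1 / (4
        pi), the weight of \<open>K\<close> in the energy, while 4 pi e / sqrt pi is the constant 4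
        sqrt pi e of \<open>c_f\<close>.\<close>
      define a b where "a = norm (grad \<psi> x)" and "b = norm (G\<phi> x) / sqrt pi"
      have "(1 / sqrt pi) * \<bar>G\<phi> x \<bullet> grad \<psi> x\<bar> \<le> (1 / sqrt pi) * (norm (G\<phi> x) * norm (grad \<psi> x))"
        by (intro mult_left_mono Cauchy_Schwarz_ineq2) auto
      also have "\<dots> = a * b" by (simp add: a_def b_def)
      also have "\<dots> \<le> a\<^sup>2 + b\<^sup>2 / 4"
        using zero_le_power2[of "a - b / 2"] by (simp add: power2_diff power_divide)
      also have "b\<^sup>2 / 4 = (1 / (4 * pi)) * (norm (G\<phi> x))\<^sup>2" by (simp add: b_def power_divide)
      finally show ?thesis by (simp add: a_def)
    qed
    let ?bd = "\<lambda>x. (norm (grad \<psi> x))\<^sup>2 + (1 / (4 * pi)) * (norm (G\<phi> x))\<^sup>2"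
    have i2: "integrable lborel ?bd"
      using integrable_grad_power2[OF \<psi>] iG\<phi> by simp
    have i1: "integrable lborel (\<lambda>x. (1 / sqrt pi) * (G\<phi> x \<bullet> grad \<psi> x))"
      by (rule Bochner_Integration.integrable_bound[OF i2])
         (measurable, use order_trans[OF ptw abs_ge_self] in \<open>auto simp: abs_mult\<close>)
    have "4 * sqrt pi * e * (\<integral>x. (u x)\<^sup>2 * \<psi> x \<partial>lborel) = (1 / sqrt pi) * (4 * pi * e * (\<integral>x. (u x)\<^sup>2 * \<psi> x \<partial>lborel))"
      by (simp add: field_simps flip: real_sqrt_mult)
    also have "\<dots> = (\<integral>x. (1 / sqrt pi) * (G\<phi> x \<bullet> grad \<psi> x) \<partial>lborel)"
      unfolding eq2[OF D12_grad_test_fun[OF \<psi>], symmetric] by (rule integral_mult_right_zero[symmetric])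
    also have "\<dots> \<le> (\<integral>x. ?bd x \<partial>lborel)"
    proof (rule integral_mono[OF i1 i2])
      fix x
      have "(1 / sqrt pi) * (G\<phi> x \<bullet> grad \<psi> x) \<le> (1 / sqrt pi) * \<bar>G\<phi> x \<bullet> grad \<psi> x\<bar>"
        by (intro mult_left_mono) auto
      with ptw[of x] show "(1 / sqrt pi) * (G\<phi> x \<bullet> grad \<psi> x) \<le> ?bd x" by linarith
    qed
    also have "\<dots> = (\<integral>x. (norm (grad \<psi> x))\<^sup>2 \<partial>lborel) + K / (4 * pi)"
      using integrable_grad_power2[OF \<psi>] iG\<phi> by (simp add: K_def)
    finally show ?thesis .
  qed
  \<comment> \<open>The additive constant \<open>A\<close> of \<open>cubic_integral_le\<close> is K
    / (4 pi), and \<open>c\<close> is 4 sqrt pi e.\<close>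
  have iQ: "integrable lborel (\<lambda>x. \<bar>u x\<bar> ^ 3)" and Q: "4 * sqrt pi * e * Q \<le> I + K / (4 * pi)"
    unfolding Q_def I_def using cubic_integral_le[OF H _ _ test] e_pos nonneg by simp_all
  have "(\<integral>x. Gu x \<bullet> Gu x + u x * u x + e * \<phi> x * u x * u x \<partial>lborel)
      = (\<integral>x. (norm (Gu x))\<^sup>2 + (u x)\<^sup>2 + e * ((u x)\<^sup>2 * \<phi> x) \<partial>lborel)"
    unfolding power2_norm_eq_inner
    by (rule Bochner_Integration.integral_cong) (auto simp: power2_eq_square)
  \<comment> \<open>Splitting the integral requires each summand to be integrable; for the coupling
    term this is \<open>iS\<close>.\<close>
  also have "\<dots> = I + J + e * S"
    using iGu iu iS by (simp add: I_def J_def S_def)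
  also have "e * S = K / (4 * pi)" by (simp add: KS)
  finally have "I + J + K / (4 * pi) = lam * (\<integral>x. \<alpha> x * f (u x) * u x \<partial>lborel)"
    using eq1[OF H] by simp
  also have "\<dots> \<le> lam * (norm_inf \<alpha> * c_f e f * (J + 4 * sqrt pi * e * Q))"
  proof (rule mult_left_mono[OF _ lam(1)])
    let ?bd = "\<lambda>x. norm_inf \<alpha> * c_f e f * ((u x)\<^sup>2 + 4 * sqrt pi * e * \<bar>u x\<bar> ^ 3)"
    have [measurable]: "\<alpha> \<in> borel_measurable borel" "f \<in> borel_measurable borel"
      using alpha f_cont by (auto simp: Linf_def intro: borel_measurable_continuous_onI)
    have ptw: "AE x in lborel. \<bar>\<alpha> x * f (u x) * u x\<bar> \<le> ?bd x"
      using AE_abs_le_norm_inf[OF alpha]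
    proof eventually_elim
      case (elim x)
      have "\<bar>\<alpha> x\<bar> * (\<bar>f (u x)\<bar> * \<bar>u x\<bar>) \<le> norm_inf \<alpha> * (c_f e f * ((u x)\<^sup>2 + 4 * sqrt pi * e * \<bar>u x\<bar> ^ 3))"
        using elim abs_ge_zero[of "\<alpha> x"]
        by (intro mult_mono abs_le_c_f[OF e_pos f_cont f1 f2]) auto
      then show ?case by (simp add: abs_mult mult.assoc)
    qed
    \<comment> \<open>\<open>iQ\<close> makes the majorant integrable, so the right-hand side of the
      first equation is a genuine integral and can be compared.\<close>
    have ibd: "integrable lborel ?bd"
      using iu iQ by (intro integrable_mult_right Bochner_Integration.integrable_add)
    have "integrable lborel (\<lambda>x. \<alpha> x * f (u x) * u x)"
      by (rule Bochner_Integration.integrable_bound[OF ibd]) (use ptw in auto)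
    then have "(\<integral>x. \<alpha> x * f (u x) * u x \<partial>lborel) \<le> (\<integral>x. ?bd x \<partial>lborel)"
      using ibd ptw by (intro integral_mono_AE) auto
    also have "\<dots> = norm_inf \<alpha> * c_f e f * (J + 4 * sqrt pi * e * Q)"
      using iu iQ by (simp add: J_def Q_def)
    finally show "(\<integral>x. \<alpha> x * f (u x) * u x \<partial>lborel) \<le> norm_inf \<alpha> * c_f e f * (J + 4 * sqrt pi * e * Q)" .
  qed
  finally have le: "I + J + K / (4 * pi) \<le> (lam * norm_inf \<alpha> * c_f e f) * (J + 4 * sqrt pi * e * Q)"
    by (simp add: mult.assoc)
  define \<theta> T where "\<theta> = lam * norm_inf \<alpha> * c_f e f" and "T = J + 4 * sqrt pi * e * Q"
  have T: "0 \<le> T" "T \<le> I + J + K / (4 * pi)" using Q nonneg e_pos by (auto simp: T_def)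
  \<comment> \<open>The energy lies between the two sides: it is at least \<open>T\<close> by
    \<open>Q\<close> and at most \<theta> times \<open>T\<close> by \<open>le\<close>. As \<theta> <
    1, this forces \<open>T\<close> to be 0, and then \<open>le\<close> forces the energy to
    vanish.\<close>
  have "T \<le> \<theta> * T" using le T unfolding \<theta>_def T_def by linarith
  then have "(1 - \<theta>) * T \<le> 0" by (simp add: algebra_simps)
  with lam(2) have "T \<le> 0" by (simp add: \<theta>_def mult_le_0_iff)
  with T(1) le have sum0: "I + J + K / (4 * pi) \<le> 0" unfolding T_def by simp
  have "K / (4 * pi) \<ge> 0" using nonneg by simp
  with sum0 nonneg have "J = 0" "K / (4 * pi) = 0" by linarith+
  then have "J = 0" "K = 0" by auto
  have "AE x in lborel. (u x)\<^sup>2 = 0"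
    using \<open>J = 0\<close> integral_nonneg_eq_0_iff_AE[OF iu] by (simp add: J_def)
  with K0[OF \<open>K = 0\<close>] show ?thesis by auto
qed

end
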